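(* Consider the rank-1 inhomogeneous random graph on $n$ vertices with i.i.d. weights having density $\rho(h)=(\tau-1)h^{-\tau}$, $h\ge1$, with $\tau\in(2,3)$, mean weight $\mu=(\tau-1)/(\tau-2)$ and connection probability $p(h,h')=\min\{hh'/(\mu n),1\}$. Put $\gamma_n=\sqrt{n\mu}$. For every fixed integer $k\ge3$, the average number $A_k(n)$ of cliques of size $k$ satisfies, as $n\to\infty$, $$A_k(n)\sim\binom nk\,\gamma_n^{k(1-\tau)}\left[1+\sum_{m=1}^{k-1}\binom km(\tau-1)^m\,m!\,J_m+\left(\frac{\tau-1}{k-\tau}\right)^k\right],$$ where, for $m=1,\dots,k-1$, $$J_m=\int_0^1\cdots\int_0^1\Big(\prod_{i=1}^m t_i^{\,i(m-\tau)-1}\Big)\,\big(\Phi_m(t_1,\dots,t_m)\big)^{k-m}\,dt_1\cdots dt_m ,$$ with $\Phi_m$ the explicit functions on $[0,1]^m$ given in the context.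
   Context: Model: the graph has $n$ vertices with i.i.d. weights $H_1,\dots,H_n$ with density $\rho$; conditionally on the weights, each pair of vertices $i\ne j$ is connected by an edge independently with probability $p(H_i,H_j)$. The average number of $k$-cliques is $$A_k(n)=\binom nk\int_1^\infty\cdots\int_1^\infty\rho(h_1)\cdots\rho(h_k)\prod_{1\le i<j\le k}\min\Big\{1,\frac{h_ih_j}{\gamma_n^2}\Big\}\,dh_1\cdots dh_k .$$ The functions $\Phi_m$ are defined for $0\le t_1,\dots,t_m\le1$ by $$\Phi_1(t_1)=t_1\Big(\frac{\tau-1}{\tau-2}-\frac{t_1^{\tau-2}}{\tau-2}\Big),$$ $$\Phi_2(t_1,t_2)=t_1t_2^{\tau-1}\Big(\frac{\tau-1}{(3-\tau)(\tau-2)}-\frac{t_1^{\tau-2}}{\tau-2}-\frac{\tau-1}{3-\tau}\,t_2^{3-\tau}\Big),$$ and for $m\ge3$ $$\Phi_m(t_1,\dots,t_m)=t_1t_2^{\tau-1}\cdots t_m^{\tau-1}\Big(\frac{\tau-1}{(3-\tau)(\tau-2)}-\frac{t_1^{\tau-2}}{\tau-2}-\sum_{j=3}^m\frac{\tau-1}{(j+1-\tau)(j-\tau)}\,t_2^{3-\tau}t_3^{4-\tau}\cdots t_{j-1}^{j-\tau}-\frac{\tau-1}{m+1-\tau}\,t_2^{3-\tau}t_3^{4-\tau}\cdots t_m^{m+1-\tau}\Big).$$ Notation: $g_1(n)\sim g_2(n)$ means $g_1(n)/g_2(n)\to1$ as $n\to\infty$. *)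

theory Defs
  imports "HOL-Probability.Probability" "HOL-Library.Ramsey" "HOL-Library.Landau_Symbols"
begin

section \<open>The rank-1 inhomogeneous random graph\<close>

definition weight_density :: "real \<Rightarrow> real \<Rightarrow> real" where
  "weight_density \<tau> h = (if h \<ge> 1 then (\<tau> - 1) * h powr (- \<tau>) else 0)"

definition mean_weight :: "real \<Rightarrow> real" where
  "mean_weight \<tau> = (\<tau> - 1) / (\<tau> - 2)"

definition gamma_n :: "real \<Rightarrow> nat \<Rightarrow> real" where
  "gamma_n \<tau> n = sqrt (real n * mean_weight \<tau>)"

definition connection_prob :: "real \<Rightarrow> nat \<Rightarrow> real \<Rightarrow> real \<Rightarrow> real" where
  "connection_prob \<tau> n h h' = min (h * h' / (mean_weight \<tau> * real n)) 1"

text \<open>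
  A graph on the vertex set \<open>{1..n}\<close> is given by its edge set, a set of two-element subsets of
  \<open>{1..n}\<close>.  The following is the conditional law of the graph for given weights \<open>h 1, \<dots>, h n\<close>
  and connection function \<open>p\<close>: each pair \<open>e\<close> is an edge, independently, with probability
  \<open>p (h i) (h j)\<close>, where \<open>i = Min e\<close> and \<open>j = Max e\<close> are the two endpoints (the order in which
  they are taken is immaterial for symmetric \<open>p\<close>).
\<close>

definition conditional_graph :: "nat \<Rightarrow> (real \<Rightarrow> real \<Rightarrow> real) \<Rightarrow> (nat \<Rightarrow> real) \<Rightarrow> nat set set pmf" where
  "conditional_graph n p h =
     map_pmf (\<lambda>X. {e. X e})
       (Pi_pmf ([{1..n}]\<^bsup>2\<^esup>) False (\<lambda>e. bernoulli_pmf (p (h (Min e)) (h (Max e)))))"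

text \<open>The unconditional law: the weights are first drawn independently with density \<open>\<rho>\<close>.\<close>

definition inhomogeneous_random_graph ::
    "nat \<Rightarrow> (real \<Rightarrow> real) \<Rightarrow> (real \<Rightarrow> real \<Rightarrow> real) \<Rightarrow> nat set set measure" where
  "inhomogeneous_random_graph n \<rho> p =
     (\<Pi>\<^sub>M i\<in>{1..n}. density lborel (\<lambda>x. ennreal (\<rho> x))) \<bind>
       (\<lambda>h. measure_pmf (conditional_graph n p h))"

definition num_cliques :: "nat \<Rightarrow> nat \<Rightarrow> nat set set \<Rightarrow> nat" where
  "num_cliques n k E = card {S \<in> [{1..n}]\<^bsup>k\<^esup>. clique S E}"

definition avg_cliques :: "real \<Rightarrow> nat \<Rightarrow> nat \<Rightarrow> real" where
  "avg_cliques \<tau> k n =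
     (LINT E | inhomogeneous_random_graph n (weight_density \<tau>) (connection_prob \<tau> n).
        real (num_cliques n k E))"


section \<open>The limiting constants\<close>

text \<open>A point \<open>(t\<^sub>1, \<dots>, t\<^sub>m)\<close> is a function \<open>t\<close> on \<open>{1..m}\<close>.\<close>

definition Phi :: "real \<Rightarrow> nat \<Rightarrow> (nat \<Rightarrow> real) \<Rightarrow> real" where
  "Phi \<tau> m t =
    (if m = 1 then
       t 1 * ((\<tau> - 1) / (\<tau> - 2) - t 1 powr (\<tau> - 2) / (\<tau> - 2))
     else if m = 2 then
       t 1 * t 2 powr (\<tau> - 1) *
         ((\<tau> - 1) / ((3 - \<tau>) * (\<tau> - 2)) - t 1 powr (\<tau> - 2) / (\<tau> - 2)
          - (\<tau> - 1) / (3 - \<tau>) * t 2 powr (3 - \<tau>))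
     else
       t 1 * (\<Prod>i=2..m. t i powr (\<tau> - 1)) *
         ((\<tau> - 1) / ((3 - \<tau>) * (\<tau> - 2)) - t 1 powr (\<tau> - 2) / (\<tau> - 2)
          - (\<Sum>j=3..m. (\<tau> - 1) / ((real j + 1 - \<tau>) * (real j - \<tau>)) *
                        (\<Prod>i=2..j-1. t i powr (real i + 1 - \<tau>)))
          - (\<tau> - 1) / (real m + 1 - \<tau>) * (\<Prod>i=2..m. t i powr (real i + 1 - \<tau>))))"

definition J :: "real \<Rightarrow> nat \<Rightarrow> nat \<Rightarrow> real" where
  "J \<tau> k m =
     (LINT t : (\<Pi>\<^sub>E i\<in>{1..m}. {0..1}) | (\<Pi>\<^sub>M i\<in>{1..m}. lborel).
        (\<Prod>i=1..m. t i powr (real i * (real m - \<tau>) - 1)) * Phi \<tau> m t ^ (k - m))"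


section \<open>Well-definedness of the model\<close>

lemma nn_integral_powr_from_1:
  fixes a c :: real
  assumes "a < -1" "c \<ge> 0"
  shows "(\<integral>\<^sup>+x. ennreal (if x \<ge> 1 then c * x powr a else 0) \<partial>lborel) = ennreal (c / (- a - 1))"
proof -
  have "(\<integral>\<^sup>+x. ennreal (c * x powr a) * indicator {1..} x \<partial>lborel)
        = ennreal (0 - c * 1 powr (a + 1) / (a + 1))"
  proof (rule nn_integral_FTC_atLeast[where F = "\<lambda>x. c * x powr (a + 1) / (a + 1)"])
    show "DERIV (\<lambda>x. c * x powr (a + 1) / (a + 1)) x :> c * x powr a" if "1 \<le> x" for x
    proof -
      have "DERIV (\<lambda>x. c * x powr (a + 1) / (a + 1)) x :> c * ((a + 1) * x powr a) / (a + 1)"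
        using that assms by (auto intro!: derivative_eq_intros)
      then show ?thesis using assms by simp
    qed
    show "((\<lambda>x. c * x powr (a + 1) / (a + 1)) \<longlongrightarrow> 0) at_top"
    proof -
      have "((\<lambda>x::real. x powr (a + 1)) \<longlongrightarrow> 0) at_top"
        using assms by (intro tendsto_neg_powr filterlim_ident) auto
      then have "((\<lambda>x. c / (a + 1) * x powr (a + 1)) \<longlongrightarrow> c / (a + 1) * 0) at_top"
        by (rule tendsto_mult_left)
      then show ?thesis by simp
    qed
  qed (use assms in auto)
  moreover have "0 - c * 1 powr (a + 1) / (a + 1) = c / (- a - 1)"
    using assms by (simp add: field_simps)
  moreover have "(\<lambda>x. ennreal (c * x powr a) * indicator {1..} x)
      = (\<lambda>x. ennreal (if x \<ge> 1 then c * x powr a else 0))"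
    by (auto simp: indicator_def)
  ultimately show ?thesis by simp
qed

lemma weight_density_measurable [measurable]: "weight_density \<tau> \<in> borel_measurable borel"
  unfolding weight_density_def by measurable

lemma prob_space_weight:
  assumes "\<tau> > 1"
  shows "prob_space (density lborel (\<lambda>x. ennreal (weight_density \<tau> x)))"
proof
  show "emeasure (density lborel (\<lambda>x. ennreal (weight_density \<tau> x)))
          (space (density lborel (\<lambda>x. ennreal (weight_density \<tau> x)))) = 1"
    using nn_integral_powr_from_1[of "-\<tau>" "\<tau> - 1"] assms
    by (simp add: emeasure_density weight_density_def)
qed

lemma mean_weight:
  assumes "\<tau> > 2"
  shows "(LINT x | density lborel (\<lambda>x. ennreal (weight_density \<tau> x)). x) = mean_weight \<tau>"
proof -
  have "(LINT x | density lborel (\<lambda>x. ennreal (weight_density \<tau> x)). x)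
        = (LINT x | lborel. weight_density \<tau> x * x)"
    using assms by (subst integral_density) (auto simp: weight_density_def)
  also have "(\<lambda>x. weight_density \<tau> x * x) = (\<lambda>x. if x \<ge> 1 then (\<tau> - 1) * x powr (1 - \<tau>) else 0)"
    by (auto simp: weight_density_def fun_eq_iff powr_diff powr_minus field_simps)
  also have "(LINT x | lborel. (if x \<ge> 1 then (\<tau> - 1) * x powr (1 - \<tau>) else 0)) = mean_weight \<tau>"
    using nn_integral_powr_from_1[of "1 - \<tau>" "\<tau> - 1"] assms
    by (subst integral_eq_nn_integral) (auto simp: mean_weight_def)
  finally show ?thesis .
qed

lemma conditional_graph_measurable [measurable]:
  assumes [measurable]: "case_prod p \<in> borel_measurable (borel \<Otimes>\<^sub>M borel)"
  shows "(\<lambda>h. measure_pmf (conditional_graph n p h))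
           \<in> (\<Pi>\<^sub>M i\<in>{1..n}. borel) \<rightarrow>\<^sub>M prob_algebra (count_space UNIV)"
proof (rule measurable_prob_algebraI)
  let ?P = "[{1..n}]\<^bsup>2\<^esup>"
  have fin: "finite ?P" by (simp add: finite_imp_finite_nsets)
  show "(\<lambda>h. measure_pmf (conditional_graph n p h))
           \<in> (\<Pi>\<^sub>M i\<in>{1..n}. borel) \<rightarrow>\<^sub>M subprob_algebra (count_space UNIV)"
  proof (rule measurable_subprob_algebra)
    fix A :: "nat set set set"
    have sub: "set_pmf (conditional_graph n p h) \<subseteq> Pow ?P" for h
      using set_Pi_pmf_subset[OF fin, of False] unfolding conditional_graph_def by fastforce
    have pmf_eq: "pmf (conditional_graph n p h) E =
        (\<Prod>e\<in>?P. pmf (bernoulli_pmf (p (h (Min e)) (h (Max e)))) (e \<in> E))" if "E \<subseteq> ?P" for h E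
    proof -
      have "pmf (conditional_graph n p h) (Collect (\<lambda>e. e \<in> E)) = 
          pmf (Pi_pmf ?P False (\<lambda>e. bernoulli_pmf (p (h (Min e)) (h (Max e))))) (\<lambda>e. e \<in> E)"
        unfolding conditional_graph_def by (rule pmf_map_inj') (auto simp: inj_def fun_eq_iff)
      also have "\<dots> = (\<Prod>e\<in>?P. pmf (bernoulli_pmf (p (h (Min e)) (h (Max e)))) (e \<in> E))"
        using that by (intro pmf_Pi' fin) auto
      finally show ?thesis by simp
    qed
    have eq: "emeasure (measure_pmf (conditional_graph n p h)) A =
        ennreal (\<Sum>E\<in>A \<inter> Pow ?P. \<Prod>e\<in>?P. pmf (bernoulli_pmf (p (h (Min e)) (h (Max e)))) (e \<in> E))"
      for h
    proof -
      have "emeasure (measure_pmf (conditional_graph n p h)) A =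
            emeasure (measure_pmf (conditional_graph n p h)) (A \<inter> Pow ?P)"
        using sub[of h] by (intro emeasure_eq_AE) (auto simp: AE_measure_pmf_iff)
      also have "\<dots> = ennreal (\<Sum>E\<in>A \<inter> Pow ?P. pmf (conditional_graph n p h) E)"
        using fin by (simp add: emeasure_measure_pmf_finite sum_ennreal)
      also have "(\<Sum>E\<in>A \<inter> Pow ?P. pmf (conditional_graph n p h) E) = 
         (\<Sum>E\<in>A \<inter> Pow ?P. \<Prod>e\<in>?P. pmf (bernoulli_pmf (p (h (Min e)) (h (Max e)))) (e \<in> E))"
        by (intro sum.cong) (auto simp: pmf_eq)
      finally show ?thesis .
    qed
    have pb: "pmf (bernoulli_pmf q) b = (if b then min 1 (max 0 q) else 1 - min 1 (max 0 q))" for q b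
      by (auto simp: bernoulli_pmf.rep_eq min_def max_def)
    have mm: "Min e \<in> {1..n}" "Max e \<in> {1..n}" if "e \<in> ?P" for e
    proof -
      have "finite e" "e \<noteq> {}" "e \<subseteq> {1..n}" using that by (auto simp: nsets_def)
      then show "Min e \<in> {1..n}" "Max e \<in> {1..n}" using Min_in Max_in by blast+
    qed
    have [measurable]: "(\<lambda>h. p (h (Min e)) (h (Max e))) \<in> borel_measurable (\<Pi>\<^sub>M i\<in>{1..n}. borel)"
      if "e \<in> ?P" for e
    proof -
      have "(\<lambda>h. case_prod p (h (Min e), h (Max e))) \<in> borel_measurable (\<Pi>\<^sub>M i\<in>{1..n}. borel)"
        using mm[OF that] by (intro measurable_compose[OF _ assms]) measurable
      then show ?thesis by simp
    qed
    show "(\<lambda>h. emeasure (measure_pmf (conditional_graph n p h)) A)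
            \<in> borel_measurable (\<Pi>\<^sub>M i\<in>{1..n}. borel)"
      unfolding eq pb by measurable
  qed (auto intro: measure_pmf.subprob_space_axioms)
qed (auto intro: measure_pmf.prob_space_axioms)

lemma prob_space_inhomogeneous_random_graph:
  assumes "\<tau> > 1"
  shows "prob_space (inhomogeneous_random_graph n (weight_density \<tau>) (connection_prob \<tau> n))"
proof -
  let ?D = "density lborel (\<lambda>x. ennreal (weight_density \<tau> x))"
  interpret product_prob_space "\<lambda>_. ?D" "{1..n}"
    by (intro product_prob_spaceI prob_space_weight assms)
  have [measurable]: "case_prod (connection_prob \<tau> n) \<in> borel_measurable (borel \<Otimes>\<^sub>M borel)"
    unfolding connection_prob_def by measurable
  have "(\<lambda>h. measure_pmf (conditional_graph n (connection_prob \<tau> n) h))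
          \<in> (\<Pi>\<^sub>M i\<in>{1..n}. ?D) \<rightarrow>\<^sub>M prob_algebra (count_space UNIV)"
    using conditional_graph_measurable[of "connection_prob \<tau> n" n]
    by (subst measurable_cong_sets[OF sets_PiM_cong refl]) auto
  moreover have "(\<Pi>\<^sub>M i\<in>{1..n}. ?D) \<in> space (prob_algebra (\<Pi>\<^sub>M i\<in>{1..n}. ?D))"
    using P.prob_space_axioms by (simp add: space_prob_algebra)
  ultimately show ?thesis
    unfolding inhomogeneous_random_graph_def using prob_space_bind' by blast
qed

end

theory Submission
  imports Defs
begin

text \<open>
  By linearity and independence, \<open>A\<^sub>k(n)\<close> is \<open>n choose k\<close> times the expectation of the product of
  the connection probabilities over the pairs of \<open>k\<close> vertices.  After the substitution
  \<open>h = \<gamma>\<^sub>n x\<close> this is \<open>\<gamma>\<^sub>n\<^bsup>k(1-\<tau>)\<^esup>\<close> times an integral over \<open>[1/\<gamma>\<^sub>n, \<infinity>)\<^sup>k\<close> whose integrand does not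
  depend on \<open>n\<close>, so it increases to the integral over \<open>(0, \<infinity>)\<^sup>k\<close>.

  To evaluate the latter, split according to the set \<open>T\<close> of those \<open>m\<close> points that are at most \<open>1\<close>.
  Pairs inside \<open>T\<close> contribute \<open>x\<^sub>i x\<^sub>j\<close>, pairs outside \<open>T\<close> contribute \<open>1\<close>, so given the points
  of \<open>T\<close> the large points are independent and the integral over them is the \<open>(k - m)\<close>-th power of
  \<open>\<integral>\<^sub>1\<^sup>\<infinity> (\<tau> - 1) y\<^bsup>-\<tau>\<^esup> \<Prod>\<^sub>i min 1 (x\<^sub>i y) dy\<close>.  Ordering the points of \<open>T\<close> as \<open>x\<^sub>i = t\<^sub>i \<cdots> t\<^sub>m\<close> gives the
  factor \<open>m!\<close>, the exponents of the \<open>t\<^sub>i\<close>, and turns that integral into \<open>\<Phi>\<^sub>m(t)\<close>.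
\<close>

subsection \<open>Finite products of Lebesgue measure\<close>

text \<open>Integrals are kept in the extended nonnegative reals, where Fubini and monotone
  convergence ask for no integrability. Finiteness becomes an issue only for \<open>J\<close>: it is
  a Bochner integral, with value 0 for a non-integrable integrand, and for m = 1, 2 the powers of
  t_i in front of \<Phi>_m have exponents below -1. The vanishing of \<Phi>_m as t_i tends to 0 has
  to compensate, and for t_1 it does so exactly when k > \<tau>. Finite values of \<open>J\<close>
  give a finite limit, and the subset T = {} contributes 1, so the limit is positive and may be
  divided by.

  The shape of \<Phi>_m comes from cutting the half-line y \<ge> 1 at 1/x_m, ..., 1/x_1, the points
  where the minima saturate one after the other. Between two cuts the integrand is a pure power, so
  the integral is a sum of differences of boundary values; summation by parts turns it into the
  closed formula.\<close>

interpretation lborel_product: product_sigma_finite "\<lambda>_ :: nat. lborel :: real measure"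
  by (simp add: product_sigma_finite_def lborel.sigma_finite_measure_axioms)

text \<open>One-dimensional affine substitution, coordinate by coordinate. It serves twice: to
  normalise the points below the largest one when sorting, and to pass from weights to weights
  divided by \<gamma>_n. The scaled point is restricted to \<open>I\<close> because points of the
  product space are extensional functions.\<close>

lemma nn_integral_PiM_lborel_scale:
  fixes I :: "nat set"
  assumes "finite I" "c > 0" "f \<in> borel_measurable (Pi\<^sub>M I (\<lambda>_. lborel))"
  shows "(\<integral>\<^sup>+x. f x \<partial>Pi\<^sub>M I (\<lambda>_. lborel)) =
         ennreal c ^ card I * (\<integral>\<^sup>+x. f (\<lambda>i\<in>I. c * x i) \<partial>Pi\<^sub>M I (\<lambda>_. lborel))"
  using assms(1,3)
proof (induction I arbitrary: f rule: finite_induct)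
  case empty
  then show ?case by (simp add: PiM_empty nn_integral_count_space_finite restrict_def)
next
  case (insert i I)
  note [measurable] = insert.prems
  have scaled [measurable]: "(\<lambda>x. \<lambda>j\<in>insert i I. c * x j)
      \<in> Pi\<^sub>M (insert i I) (\<lambda>_. lborel) \<rightarrow>\<^sub>M Pi\<^sub>M (insert i I) (\<lambda>_. lborel)"
    by measurable
  have "(\<integral>\<^sup>+x. f x \<partial>Pi\<^sub>M (insert i I) (\<lambda>_. lborel)) =
        (\<integral>\<^sup>+x. (\<integral>\<^sup>+y. f (x(i := y)) \<partial>lborel) \<partial>Pi\<^sub>M I (\<lambda>_. lborel))"
    using insert by (intro lborel_product.product_nn_integral_insert) auto
  also have "\<dots> = (\<integral>\<^sup>+x. ennreal c * (\<integral>\<^sup>+y. f (x(i := c * y)) \<partial>lborel) \<partial>Pi\<^sub>M I (\<lambda>_. lborel))"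
  proof (intro nn_integral_cong)
    fix x :: "nat \<Rightarrow> real" assume x: "x \<in> space (Pi\<^sub>M I (\<lambda>_. lborel))"
    have "(\<lambda>y. x(i := y)) \<in> lborel \<rightarrow>\<^sub>M Pi\<^sub>M (insert i I) (\<lambda>_. lborel)"
      using x by (intro measurable_fun_upd[where J = I]) auto
    then have "(\<lambda>y. f (x(i := y))) \<in> borel_measurable borel"
      using insert.prems by (auto dest: measurable_compose)
    from nn_integral_real_affine[OF this, of c 0] assms(2)
    show "(\<integral>\<^sup>+y. f (x(i := y)) \<partial>lborel) = ennreal c * (\<integral>\<^sup>+y. f (x(i := c * y)) \<partial>lborel)"
      by simp
  qed
  also have "\<dots> = ennreal c * (\<integral>\<^sup>+x. (\<integral>\<^sup>+y. f (x(i := c * y)) \<partial>lborel) \<partial>Pi\<^sub>M I (\<lambda>_. lborel))"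
    by (intro nn_integral_cmult) measurable
  also have "(\<integral>\<^sup>+x. (\<integral>\<^sup>+y. f (x(i := c * y)) \<partial>lborel) \<partial>Pi\<^sub>M I (\<lambda>_. lborel)) =
     ennreal c ^ card I * (\<integral>\<^sup>+x. (\<integral>\<^sup>+y. f ((\<lambda>j\<in>I. c * x j)(i := c * y)) \<partial>lborel) \<partial>Pi\<^sub>M I (\<lambda>_. lborel))"
    by (rule insert.IH) measurable
  also have "(\<integral>\<^sup>+x. (\<integral>\<^sup>+y. f ((\<lambda>j\<in>I. c * x j)(i := c * y)) \<partial>lborel) \<partial>Pi\<^sub>M I (\<lambda>_. lborel)) =
     (\<integral>\<^sup>+x. (\<integral>\<^sup>+y. f (\<lambda>j\<in>insert i I. c * (x(i := y)) j) \<partial>lborel) \<partial>Pi\<^sub>M I (\<lambda>_. lborel))"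
    using insert.hyps
    by (intro nn_integral_cong arg_cong[of _ _ f]) (auto simp: restrict_def fun_eq_iff)
  also have "\<dots> = (\<integral>\<^sup>+x. f (\<lambda>j\<in>insert i I. c * x j) \<partial>Pi\<^sub>M (insert i I) (\<lambda>_. lborel))"
    using insert.hyps by (intro lborel_product.product_nn_integral_insert[symmetric]) measurable
  finally show ?case using insert.hyps by (simp add: mult.assoc del: restrict_apply)
qed

text \<open>A product measure is determined by its values on boxes, and on a box the integral of the
  product density factorises. This moves the law of the i.i.d. weights to Lebesgue measure, where
  scaling is available.\<close>

lemma nn_integral_PiM_density:
  fixes I :: "nat set" and w :: "real \<Rightarrow> ennreal"
  assumes "finite I" and [measurable]: "w \<in> borel_measurable borel"
    and sf: "sigma_finite_measure (density lborel w)"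
    and [measurable]: "f \<in> borel_measurable (Pi\<^sub>M I (\<lambda>_. lborel))"
  shows "(\<integral>\<^sup>+x. f x \<partial>Pi\<^sub>M I (\<lambda>_. density lborel w)) =
         (\<integral>\<^sup>+x. (\<Prod>i\<in>I. w (x i)) * f x \<partial>Pi\<^sub>M I (\<lambda>_. lborel))"
proof -
  interpret D: product_sigma_finite "\<lambda>_ :: nat. density lborel w"
    by (simp add: product_sigma_finite_def sf)
  have "density (Pi\<^sub>M I (\<lambda>_. lborel)) (\<lambda>x. \<Prod>i\<in>I. w (x i)) = Pi\<^sub>M I (\<lambda>_. density lborel w)"
  proof (rule D.PiM_eqI)
    fix A assume A: "\<And>i. i \<in> I \<Longrightarrow> A i \<in> sets (density lborel w)"
    then have [measurable]: "Pi\<^sub>E I A \<in> sets (Pi\<^sub>M I (\<lambda>_. lborel))"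
      using assms(1) by (intro sets_PiM_I_finite) auto
    have "emeasure (density (Pi\<^sub>M I (\<lambda>_. lborel)) (\<lambda>x. \<Prod>i\<in>I. w (x i))) (Pi\<^sub>E I A) =
          (\<integral>\<^sup>+x. (\<Prod>i\<in>I. w (x i)) * indicator (Pi\<^sub>E I A) x \<partial>Pi\<^sub>M I (\<lambda>_. lborel))"
      by (intro emeasure_density) measurable
    also have "\<dots> = (\<integral>\<^sup>+x. (\<Prod>i\<in>I. w (x i) * indicator (A i) (x i)) \<partial>Pi\<^sub>M I (\<lambda>_. lborel))"
    proof (intro nn_integral_cong)
      fix x :: "nat \<Rightarrow> real" assume x: "x \<in> space (Pi\<^sub>M I (\<lambda>_. lborel))"
      have "indicator (Pi\<^sub>E I A) x = (\<Prod>i\<in>I. indicator (A i) (x i) :: ennreal)"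
      proof (cases "x \<in> Pi\<^sub>E I A")
        case True
        then show ?thesis by (auto simp: PiE_iff intro!: prod.neutral[symmetric])
      next
        case False
        \<comment> \<open>A point of the product space is already extensional, so it can leave the
          box only through a side \<open>A i\<close> with \<open>i\<close> in
          \<open>I\<close>.\<close>
        then obtain i where "i \<in> I" "x i \<notin> A i" using x by (auto simp: PiE_iff space_PiM)
        then have "(\<Prod>i\<in>I. indicator (A i) (x i) :: ennreal) = 0"
            using assms(1) by (intro prod_zero bexI[of _ i]) auto
          then show ?thesis using False by simp
      qed
      then show "(\<Prod>i\<in>I. w (x i)) * indicator (Pi\<^sub>E I A) x =
                 (\<Prod>i\<in>I. w (x i) * indicator (A i) (x i))"
        by (simp add: prod.distrib)
    qed
    also have "\<dots> = (\<Prod>i\<in>I. (\<integral>\<^sup>+x. w x * indicator (A i) x \<partial>lborel))"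
      using A assms(1) by (intro lborel_product.product_nn_integral_prod) auto
    also have "\<dots> = (\<Prod>i\<in>I. emeasure (density lborel w) (A i))"
      using A by (intro prod.cong refl emeasure_density[symmetric]) auto
    finally show "emeasure (density (Pi\<^sub>M I (\<lambda>_. lborel)) (\<lambda>x. \<Prod>i\<in>I. w (x i))) (Pi\<^sub>E I A) =
        (\<Prod>i\<in>I. emeasure (density lborel w) (A i))" .
  qed (use assms(1) in \<open>auto intro!: sets_PiM_cong\<close>)
  then show ?thesis
    by (subst (asm) eq_commute) (simp add: nn_integral_density)
qed

subsection \<open>Sorting the points of the unit cube\<close>

text \<open>The hyperplane is a box with the null side {y}; the other sides have infinite measure,
  but 0 times \<infinity> is 0 in \<open>ennreal\<close>. Hence ties with the largest point can be
  ignored when sorting.\<close>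

lemma null_coordinate_eq:
  assumes "finite (I :: nat set)" "i \<in> I"
  shows "AE x in Pi\<^sub>M I (\<lambda>_. lborel). x i \<noteq> (y :: real)"
proof (rule AE_I')
  have "emeasure (Pi\<^sub>M I (\<lambda>_. lborel)) (\<Pi>\<^sub>E j\<in>I. if j = i then {y} else UNIV) =
        (\<Prod>j\<in>I. emeasure lborel (if j = i then {y} else UNIV))"
    using assms by (intro lborel_product.emeasure_PiM) auto
  also have "\<dots> = 0"
    using assms by (intro prod_zero) auto
  finally show "(\<Pi>\<^sub>E j\<in>I. if j = i then {y} else UNIV) \<in> null_sets (Pi\<^sub>M I (\<lambda>_. lborel))"
    using assms by (auto intro!: null_setsI sets_PiM_I_finite)
  show "{x \<in> space (Pi\<^sub>M I (\<lambda>_. lborel)). \<not> x i \<noteq> y} \<subseteq> (\<Pi>\<^sub>E j\<in>I. if j = i then {y} else UNIV)"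
    by (auto simp: space_PiM PiE_iff extensional_def)
qed

text \<open>Ties are broken by the index, so that exactly one \<open>j\<close> qualifies.\<close>

definition argmax_at :: "nat set \<Rightarrow> nat \<Rightarrow> (nat \<Rightarrow> real) \<Rightarrow> bool" where
  "argmax_at T j x \<longleftrightarrow> (\<forall>i\<in>T - {j}. x i < x j \<or> (x i = x j \<and> i < j))"

text \<open>The last index attaining the maximum qualifies, and two distinct qualifying indices
  would each have to beat the other. This partition of unity cuts the cube integral into one piece
  per choice of the largest coordinate.\<close>

lemma sum_indicator_argmax_at:
  assumes "finite T" "T \<noteq> {}"
  shows "(\<Sum>j\<in>T. indicator {x. argmax_at T j x} x) = (1 :: ennreal)"
proof -
  define M where "M = Max (x ` T)"
  define j where "j = Max {i\<in>T. x i = M}"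
  have "M \<in> x ` T" using assms by (simp add: M_def)
  then have ne: "{i\<in>T. x i = M} \<noteq> {}" by auto
  then have "j \<in> {i\<in>T. x i = M}"
    unfolding j_def using assms by (intro Max_in) auto
  then have j: "j \<in> T" "x j = M"
    by auto
  have le: "x i \<le> M" if "i \<in> T" for i using assms that by (simp add: M_def)
  have lej: "i \<le> j" if "i \<in> T" "x i = M" for i
    using assms that unfolding j_def by (intro Max_ge) auto
  have max: "argmax_at T j x"
    unfolding argmax_at_def
  proof
    fix i assume "i \<in> T - {j}"
    then show "x i < x j \<or> x i = x j \<and> i < j"
      using le[of i] lej[of i] j(2) by (cases "x i = M") auto
  qed
  have uniq: "i = j" if "i \<in> T" "argmax_at T i x" for i
  proof (rule ccontr)
    assume "i \<noteq> j"
    then have "x i < x j \<or> x i = x j \<and> i < j" "x j < x i \<or> x j = x i \<and> j < i"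
      using that j(1) max unfolding argmax_at_def by auto
    then show False by auto
  qed
  have "(\<Sum>i\<in>T. indicator {x. argmax_at T i x} x) = (\<Sum>i\<in>T. if i = j then 1 else 0 :: ennreal)"
  proof (intro sum.cong refl)
    fix i assume "i \<in> T"
    then have "argmax_at T i x \<longleftrightarrow> i = j" using max uniq by blast
    then show "indicator {x. argmax_at T i x} x = (if i = j then 1 else 0 :: ennreal)"
      by (simp add: indicator_def)
  qed
  then show ?thesis using assms j(1) by simp
qed

lemma measurable_argmax_at [measurable]:
  assumes "finite T" "j \<in> T"
  shows "(\<lambda>x. indicator {x. argmax_at T j x} x :: ennreal) \<in> borel_measurable (Pi\<^sub>M T (\<lambda>_. lborel))"
proof -
  have pm: "Measurable.pred (Pi\<^sub>M T (\<lambda>_. lborel)) (\<lambda>x :: nat \<Rightarrow> real. x i < x j \<or> (x i = x j \<and> i < j))" if "i \<in> T" for i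
  proof -
    have m: "(\<lambda>x. x l) \<in> borel_measurable (Pi\<^sub>M T (\<lambda>_. lborel :: real measure))" if "l \<in> T" for l
      using measurable_component_singleton[OF that, of "\<lambda>_. lborel :: real measure"] by simp
    show ?thesis
    proof (cases "i < j")
      case True
      then have eq: "(\<lambda>x :: nat \<Rightarrow> real. x i < x j \<or> (x i = x j \<and> i < j)) = (\<lambda>x. \<not> (x j < x i))"
        by (auto simp: fun_eq_iff)
      show ?thesis unfolding eq by (intro pred_intros_logic(2) borel_measurable_pred_less m assms(2) that)
    next
      case False
      then show ?thesis by (simp add: borel_measurable_pred_less m assms(2) that)
    qed
  qed
  have "Measurable.pred (Pi\<^sub>M T (\<lambda>_. lborel)) (argmax_at T j)"
    unfolding argmax_at_def using assms(1) by (intro pred_intros_finite pm) auto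
  then show ?thesis
    by (intro borel_measurable_indicator') (auto simp: pred_def)
qed

text \<open>
  Ordering the points by size and writing the \<open>i\<close>-th smallest one as \<open>t\<^sub>i \<cdots> t\<^sub>m\<close>
  turns the integral of a symmetric function over the unit cube into \<open>m!\<close> times one over
  the ratios.  The induction peels off the largest point.  Symmetric functions are functions
  of multisets, so no relabelling of the coordinates is needed.
\<close>

lemma nn_integral_sort_unit_cube:
  fixes H :: "real multiset \<Rightarrow> ennreal" and T :: "nat set"
  assumes "\<And>T :: nat set. finite T \<Longrightarrow>
      (\<lambda>x. H (image_mset x (mset_set T))) \<in> borel_measurable (Pi\<^sub>M T (\<lambda>_. lborel))"
    and "finite T" "card T = n"
  shows "(\<integral>\<^sup>+x. (\<Prod>i\<in>T. indicator {0<..1} (x i)) * H (image_mset x (mset_set T)) \<partial>Pi\<^sub>M T (\<lambda>_. lborel)) =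
     fact n * (\<integral>\<^sup>+t. (\<Prod>i=1..n. indicator {0<..1} (t i) * ennreal (t i) ^ (i - 1)) *
        H (image_mset (\<lambda>i. \<Prod>l=i..n. t l) (mset_set {1..n})) \<partial>Pi\<^sub>M {1..n} (\<lambda>_. lborel))"
  using assms
proof (induction n arbitrary: T H)
  case 0
  then show ?case by (simp add: PiM_empty nn_integral_count_space_finite)
next
  case (Suc n)
  define F where "F T H x = (\<Prod>i\<in>T. indicator {0<..1} (x i)) * H (image_mset x (mset_set T))"
    for T :: "nat set" and H :: "real multiset \<Rightarrow> ennreal" and x :: "nat \<Rightarrow> real"
  define W where "W n H t = (\<Prod>i=1..n. indicator {0<..1} (t i) * ennreal (t i) ^ (i - 1)) *
        H (image_mset (\<lambda>i. \<Prod>l=i..n. t l) (mset_set {1..n}))"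
    for n and H :: "real multiset \<Rightarrow> ennreal" and t :: "nat \<Rightarrow> real"
  \<comment> \<open>Dividing the other points by the largest value y brings them back into the unit
    cube, and \<open>H' y\<close> is again a function of a multiset. The induction therefore has to
    generalise over \<open>H\<close>.\<close>
  define H' where "H' y M = H (add_mset y (image_mset ((*) y) M))" for y M
  note meas = Suc.prems(1)
  have [measurable]: "F T H \<in> borel_measurable (Pi\<^sub>M T (\<lambda>_. lborel))" if "finite T" for T
    using meas[OF that] that unfolding F_def by measurable
  have W_measI: "W n H \<in> borel_measurable (Pi\<^sub>M {1..n} (\<lambda>_. lborel))"
    if meas: "\<And>T :: nat set. finite T \<Longrightarrow>
      (\<lambda>x. H (image_mset x (mset_set T))) \<in> borel_measurable (Pi\<^sub>M T (\<lambda>_. lborel))" for n H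
  proof -
    have "(\<lambda>t. \<lambda>i\<in>{1..n}. \<Prod>l=i..n. t l) \<in> Pi\<^sub>M {1..n} (\<lambda>_. lborel) \<rightarrow>\<^sub>M Pi\<^sub>M {1..n} (\<lambda>_. lborel :: real measure)"
      by (intro measurable_restrict) (auto intro!: borel_measurable_prod)
    from measurable_compose[OF this meas[of "{1..n}"]]
    have "(\<lambda>t. H (image_mset (\<lambda>i\<in>{1..n}. \<Prod>l=i..n. t l) (mset_set {1..n})))
        \<in> borel_measurable (Pi\<^sub>M {1..n} (\<lambda>_. lborel))"
      by (simp del: restrict_apply)
    moreover have "image_mset (\<lambda>i\<in>{1..n}. \<Prod>l=i..n. t l) (mset_set {1..n}) =
        image_mset (\<lambda>i. \<Prod>l=i..n. t l) (mset_set {1..n})" for t :: "nat \<Rightarrow> real"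
      by (intro image_mset_cong) auto
    ultimately have [measurable]: "(\<lambda>t. H (image_mset (\<lambda>i. \<Prod>l=i..n. t l) (mset_set {1..n})))
        \<in> borel_measurable (Pi\<^sub>M {1..n} (\<lambda>_. lborel))"
      by simp
    show ?thesis unfolding W_def by measurable
  qed
  \<comment> \<open>The last ratio is the largest point itself and occurs in the product for every
    other point, so it can be pulled out. The power y^n is the Jacobian of scaling the n remaining
    points by y.\<close>
  have W_Suc: "W (Suc n) H (t(Suc n := y)) = indicator {0<..1} y * ennreal y ^ n * W n (H' y) t" for t y
  proof -
    have "(\<Prod>l=i..Suc n. (t(Suc n := y)) l) = y * (\<Prod>l=i..n. t l)" if "i \<le> Suc n" for i
    proof -
      have "{i..Suc n} = insert (Suc n) {i..n}" using that by auto
      then show ?thesis by (auto intro!: prod.cong)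
    qed
    moreover have ins: "{1..Suc n} = insert (Suc n) {1..n}" by auto
    ultimately have "image_mset (\<lambda>i. \<Prod>l=i..Suc n. (t(Suc n := y)) l) (mset_set {1..Suc n}) =
        add_mset y (image_mset ((*) y) (image_mset (\<lambda>i. \<Prod>l=i..n. t l) (mset_set {1..n})))"
      by (auto simp: image_mset.compositionality o_def intro!: image_mset_cong)
    moreover have "(\<Prod>i=1..Suc n. indicator {0<..1} ((t(Suc n := y)) i) * ennreal ((t(Suc n := y)) i) ^ (i - 1)) =
       indicator {0<..1} y * ennreal y ^ n * (\<Prod>i=1..n. indicator {0<..1} (t i) * ennreal (t i) ^ (i - 1))"
      unfolding ins by (auto intro!: prod.cong)
    ultimately show ?thesis by (simp only: W_def H'_def mult.assoc)
  qed
  have H'_meas: "(\<lambda>x. H' y (image_mset x (mset_set T))) \<in> borel_measurable (Pi\<^sub>M T (\<lambda>_. lborel))"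
    if T: "finite T" for T :: "nat set" and y
  proof -
    \<comment> \<open>A fresh index holds the extra point y, so that measurability of
      \<open>H' y\<close> over \<open>T\<close> follows from that of \<open>H\<close> over
      \<open>insert j T\<close>. This is why the measurability hypothesis ranges over all finite
      index sets.\<close>
    obtain j where j: "j \<notin> T" using T ex_new_if_finite[of T] by auto
    have "(\<lambda>x. \<lambda>i\<in>insert j T. if i = j then y else y * x i)
        \<in> Pi\<^sub>M T (\<lambda>_. lborel) \<rightarrow>\<^sub>M Pi\<^sub>M (insert j T) (\<lambda>_. lborel)"
      by (rule measurable_restrict) auto
    from measurable_compose[OF this meas[of "insert j T"]] T
    have "(\<lambda>x. H (image_mset (\<lambda>i\<in>insert j T. if i = j then y else y * x i) (mset_set (insert j T))))
        \<in> borel_measurable (Pi\<^sub>M T (\<lambda>_. lborel))"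
      by (simp del: restrict_apply)
    moreover have "image_mset (\<lambda>i\<in>insert j T. if i = j then y else y * x i) (mset_set (insert j T)) =
        add_mset y (image_mset ((*) y) (image_mset x (mset_set T)))" for x
    proof -
      have "image_mset (\<lambda>i\<in>insert j T. if i = j then y else y * x i) (mset_set T) =
            image_mset (\<lambda>i. y * x i) (mset_set T)"
        using T j by (intro image_mset_cong) auto
      then show ?thesis using T j by (simp add: image_mset.compositionality o_def del: restrict_apply) simp
    qed
    ultimately show ?thesis by (simp add: H'_def)
  qed
  note W_meas = W_measI[of H, OF meas] and W'_meas = W_measI[of "H' _", OF H'_meas]
  \<comment> \<open>The value is the same for every \<open>j\<close>, since only the number of
    remaining points enters. Summing over the n + 1 choices of \<open>j\<close> turns
    \<open>fact n\<close> into \<open>fact (Suc n)\<close>.\<close>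
  have main: "(\<integral>\<^sup>+x. indicator {x. argmax_at T j x} x * F T H x \<partial>Pi\<^sub>M T (\<lambda>_. lborel)) =
              fact n * (\<integral>\<^sup>+t. W (Suc n) H t \<partial>Pi\<^sub>M {1..Suc n} (\<lambda>_. lborel))" if "j \<in> T" for j
  proof -
    define T' where "T' = T - {j}"
    have T: "T = insert j T'" "j \<notin> T'" "finite T'" "card T' = n"
      using that Suc.prems(2,3) by (auto simp: T'_def)
    have "(\<integral>\<^sup>+x. indicator {x. argmax_at T j x} x * F T H x \<partial>Pi\<^sub>M T (\<lambda>_. lborel)) =
      (\<integral>\<^sup>+y. \<integral>\<^sup>+x. indicator {x. argmax_at T j x} (x(j := y)) * F T H (x(j := y)) \<partial>Pi\<^sub>M T' (\<lambda>_. lborel) \<partial>lborel)"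
      unfolding T(1) using T by (intro lborel_product.product_nn_integral_insert_rev) auto
    also have "\<dots> = (\<integral>\<^sup>+y. indicator {0<..1} y * (fact n * ennreal y ^ n *
         (\<integral>\<^sup>+t. W n (H' y) t \<partial>Pi\<^sub>M {1..n} (\<lambda>_. lborel))) \<partial>lborel)"
    proof (intro nn_integral_cong)
      fix y :: real
      show "(\<integral>\<^sup>+x. indicator {x. argmax_at T j x} (x(j := y)) * F T H (x(j := y)) \<partial>Pi\<^sub>M T' (\<lambda>_. lborel)) =
        indicator {0<..1} y * (fact n * ennreal y ^ n *
         (\<integral>\<^sup>+t. W n (H' y) t \<partial>Pi\<^sub>M {1..n} (\<lambda>_. lborel)))"
      proof (cases "y \<in> {0<..1}")
        case False
        then have "F T H (x(j := y)) = 0" for x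
          using T by (simp add: F_def)
        then show ?thesis using False by simp
      next
        case True
        have scaled: "(\<lambda>x. (\<Prod>i\<in>T'. indicator {0<..1} (x i / y)) *
              H' y (image_mset (\<lambda>i. x i / y) (mset_set T'))) \<in> borel_measurable (Pi\<^sub>M T' (\<lambda>_. lborel))"
        proof -
          have *: "(\<lambda>x. \<lambda>i\<in>T'. x i / y) \<in> Pi\<^sub>M T' (\<lambda>_. lborel) \<rightarrow>\<^sub>M Pi\<^sub>M T' (\<lambda>_. lborel)"
            by (rule measurable_restrict) auto
          have "image_mset (\<lambda>i\<in>T'. x i / y) (mset_set T') = image_mset (\<lambda>i. x i / y) (mset_set T')" for x
            using T by (intro image_mset_cong) auto
          then have [measurable]: "(\<lambda>x. H' y (image_mset (\<lambda>i. x i / y) (mset_set T')))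
              \<in> borel_measurable (Pi\<^sub>M T' (\<lambda>_. lborel))"
            using measurable_compose[OF * H'_meas[OF T(3), of y]] by simp
          show ?thesis by measurable
        qed
        have "(\<integral>\<^sup>+x. indicator {x. argmax_at T j x} (x(j := y)) * F T H (x(j := y)) \<partial>Pi\<^sub>M T' (\<lambda>_. lborel)) =
          (\<integral>\<^sup>+x. (\<Prod>i\<in>T'. indicator {0<..1} (x i / y)) *
              H' y (image_mset (\<lambda>i. x i / y) (mset_set T')) \<partial>Pi\<^sub>M T' (\<lambda>_. lborel))"
        proof (rule nn_integral_cong_AE)
          have "AE x in Pi\<^sub>M T' (\<lambda>_. lborel). \<forall>i\<in>T'. x i \<noteq> y"
            using T(3) by (intro AE_finite_allI null_coordinate_eq) auto
          then show "AE x in Pi\<^sub>M T' (\<lambda>_. lborel).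
             indicator {x. argmax_at T j x} (x(j := y)) * F T H (x(j := y)) =
             (\<Prod>i\<in>T'. indicator {0<..1} (x i / y)) * H' y (image_mset (\<lambda>i. x i / y) (mset_set T'))"
          proof eventually_elim
            case (elim x)
            have upd: "image_mset (x(j := y)) (mset_set T) = add_mset y (image_mset x (mset_set T'))"
              using T by (auto intro!: image_mset_cong)
            have H: "H (image_mset (x(j := y)) (mset_set T)) = H' y (image_mset (\<lambda>i. x i / y) (mset_set T'))"
              using True unfolding upd H'_def by (simp add: image_mset.compositionality o_def)
            have P: "(\<Prod>i\<in>T. indicator {0<..1} ((x(j := y)) i)) = (\<Prod>i\<in>T'. indicator {0<..1} (x i) :: ennreal)"
              using True T by (auto intro!: prod.cong)
            \<comment> \<open>If all other points lie in (0, y], the cube constraint follows from y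
              \<le> 1 and both sides are 1; with ties excluded, y is then a strict maximum.
              Otherwise some point is nonpositive or exceeds y, and both sides vanish.\<close>
            have Q: "indicator {x. argmax_at T j x} (x(j := y)) * (\<Prod>i\<in>T'. indicator {0<..1} (x i)) =
                  (\<Prod>i\<in>T'. indicator {0<..1} (x i / y) :: ennreal)"
            proof (cases "\<forall>i\<in>T'. 0 < x i \<and> x i \<le> y")
              case c: True
              have "argmax_at T j (x(j := y))"
                using c elim T unfolding argmax_at_def by (fastforce simp: less_le)
              moreover have "(\<Prod>i\<in>T'. indicator {0<..1} (x i) :: ennreal) = 1"
                using c True by (intro prod.neutral) force
              moreover have "(\<Prod>i\<in>T'. indicator {0<..1} (x i / y) :: ennreal) = 1"
                using c True by (intro prod.neutral) (force simp: divide_simps)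
              ultimately show ?thesis by simp
            next
              case c: False
              then obtain i where i: "i \<in> T'" "\<not> (0 < x i \<and> x i \<le> y)" by auto
              have "(\<Prod>i\<in>T'. indicator {0<..1} (x i / y) :: ennreal) = 0"
                using i True T(3) by (intro prod_zero bexI[of _ i]) (auto simp: divide_simps indicator_def)
              moreover have "indicator {x. argmax_at T j x} (x(j := y)) * (\<Prod>i\<in>T'. indicator {0<..1} (x i) :: ennreal) = 0"
              proof (cases "0 < x i")
                case True
                then have "\<not> argmax_at T j (x(j := y))"
                  using i T(1,2) unfolding argmax_at_def by (auto intro!: bexI[of _ i])
                then show ?thesis by simp
              next
                case False
                then have "(\<Prod>i\<in>T'. indicator {0<..1} (x i) :: ennreal) = 0"
                  using i T(3) by (intro prod_zero bexI[of _ i]) auto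
                then show ?thesis by simp
              qed
              ultimately show ?thesis by (simp only:)
            qed
            have "F T H (x(j := y)) = (\<Prod>i\<in>T'. indicator {0<..1} (x i)) * H' y (image_mset (\<lambda>i. x i / y) (mset_set T'))"
              unfolding F_def P H ..
            then show ?case unfolding Q[symmetric] by (simp only: mult.assoc)
          qed
        qed
        also have "\<dots> = ennreal y ^ n * (\<integral>\<^sup>+x. (\<Prod>i\<in>T'. indicator {0<..1} (x i)) *
              H' y (image_mset x (mset_set T')) \<partial>Pi\<^sub>M T' (\<lambda>_. lborel))"
        proof -
          have 1: "image_mset (\<lambda>i. (\<lambda>i\<in>T'. y * x i) i / y) (mset_set T') = image_mset x (mset_set T')" for x
            using True T by (intro image_mset_cong) auto
          have 2: "(\<Prod>i\<in>T'. indicator {0<..1} ((\<lambda>i\<in>T'. y * x i) i / y)) =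
                (\<Prod>i\<in>T'. indicator {0<..1} (x i) :: ennreal)" for x
            using True by (intro prod.cong) auto
          show ?thesis
            by (subst nn_integral_PiM_lborel_scale[OF T(3) _ scaled, of y]) (use True in \<open>simp_all only: 1 2 T(4), simp\<close>)
        qed
        also have "(\<integral>\<^sup>+x. (\<Prod>i\<in>T'. indicator {0<..1} (x i)) *
              H' y (image_mset x (mset_set T')) \<partial>Pi\<^sub>M T' (\<lambda>_. lborel)) =
              fact n * (\<integral>\<^sup>+t. W n (H' y) t \<partial>Pi\<^sub>M {1..n} (\<lambda>_. lborel))"
          unfolding W_def using H'_meas T by (intro Suc.IH) auto
        moreover have "indicator {0<..1} y = (1 :: ennreal)" using True by simp
        ultimately show ?thesis by (simp only: mult_ac mult_1_left)
      qed
    qed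
    also have "\<dots> = (\<integral>\<^sup>+y. fact n * (\<integral>\<^sup>+t. W (Suc n) H (t(Suc n := y)) \<partial>Pi\<^sub>M {1..n} (\<lambda>_. lborel)) \<partial>lborel)"
    proof (intro nn_integral_cong)
      fix y :: real
      have "(\<integral>\<^sup>+t. W (Suc n) H (t(Suc n := y)) \<partial>Pi\<^sub>M {1..n} (\<lambda>_. lborel)) =
            indicator {0<..1} y * ennreal y ^ n * (\<integral>\<^sup>+t. W n (H' y) t \<partial>Pi\<^sub>M {1..n} (\<lambda>_. lborel))"
        unfolding W_Suc by (intro nn_integral_cmult W'_meas)
      then show "indicator {0<..1} y * (fact n * ennreal y ^ n * (\<integral>\<^sup>+t. W n (H' y) t \<partial>Pi\<^sub>M {1..n} (\<lambda>_. lborel))) =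
          fact n * (\<integral>\<^sup>+t. W (Suc n) H (t(Suc n := y)) \<partial>Pi\<^sub>M {1..n} (\<lambda>_. lborel))"
        by (simp only: mult_ac)
    qed
    also have "\<dots> = fact n * (\<integral>\<^sup>+t. W (Suc n) H t \<partial>Pi\<^sub>M {1..Suc n} (\<lambda>_. lborel))"
    proof -
      interpret I: finite_product_sigma_finite "\<lambda>_. lborel :: real measure" "{1..n}"
        by standard simp
      have ins: "{1..Suc n} = insert (Suc n) {1..n}" by auto
      have [measurable]: "(\<lambda>t. W (Suc n) H t) \<in> borel_measurable (Pi\<^sub>M (insert (Suc n) {1..n}) (\<lambda>_. lborel))"
        using W_meas[of "Suc n"] unfolding ins .
      have "(\<integral>\<^sup>+t. W (Suc n) H t \<partial>Pi\<^sub>M {1..Suc n} (\<lambda>_. lborel)) =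
            (\<integral>\<^sup>+y. (\<integral>\<^sup>+t. W (Suc n) H (t(Suc n := y)) \<partial>Pi\<^sub>M {1..n} (\<lambda>_. lborel)) \<partial>lborel)"
        unfolding ins by (rule lborel_product.product_nn_integral_insert_rev) measurable
      moreover have "(\<lambda>y. \<integral>\<^sup>+t. W (Suc n) H (t(Suc n := y)) \<partial>Pi\<^sub>M {1..n} (\<lambda>_. lborel)) \<in> borel_measurable lborel"
      proof (rule I.borel_measurable_nn_integral)
        show "(\<lambda>(y, t). W (Suc n) H (t(Suc n := y))) \<in> borel_measurable (lborel \<Otimes>\<^sub>M Pi\<^sub>M {1..n} (\<lambda>_. lborel))"
          by measurable
      qed
      ultimately show ?thesis by (simp only: nn_integral_cmult)
    qed
    finally show ?thesis .
  qed
  have T_ne: "T \<noteq> {}" using Suc.prems(3) by auto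
  have summand_meas: "(\<lambda>x. indicator {x. argmax_at T j x} x * F T H x) \<in> borel_measurable (Pi\<^sub>M T (\<lambda>_. lborel))"
    if "j \<in> T" for j
  proof -
    note [measurable] = measurable_argmax_at[OF Suc.prems(2) that]
    show ?thesis using Suc.prems(2) by measurable
  qed
  have "(\<integral>\<^sup>+x. F T H x \<partial>Pi\<^sub>M T (\<lambda>_. lborel)) =
        (\<integral>\<^sup>+x. (\<Sum>j\<in>T. indicator {x. argmax_at T j x} x * F T H x) \<partial>Pi\<^sub>M T (\<lambda>_. lborel))"
    using T_ne by (simp only: sum_distrib_right[symmetric] sum_indicator_argmax_at[OF Suc.prems(2) T_ne] mult_1_left)
  also have "\<dots> = (\<Sum>j\<in>T. (\<integral>\<^sup>+x. indicator {x. argmax_at T j x} x * F T H x \<partial>Pi\<^sub>M T (\<lambda>_. lborel)))"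
    by (rule nn_integral_sum) (rule summand_meas)
  also have "\<dots> = (\<Sum>j\<in>T. fact n * (\<integral>\<^sup>+t. W (Suc n) H t \<partial>Pi\<^sub>M {1..Suc n} (\<lambda>_. lborel)))"
    by (intro sum.cong refl main)
  also have "\<dots> = fact (Suc n) * (\<integral>\<^sup>+t. W (Suc n) H t \<partial>Pi\<^sub>M {1..Suc n} (\<lambda>_. lborel))"
    unfolding sum_constant Suc.prems(3) by (simp only: fact_Suc mult.assoc)
  finally show ?case unfolding F_def W_def .
qed

subsection \<open>The functions \<open>\<Phi>\<^sub>m\<close>\<close>

lemma nn_integral_powr_Icc:
  fixes a b c e :: real
  assumes "0 < a" "a \<le> b" "c \<ge> 0" "e \<noteq> -1"
  shows "(\<integral>\<^sup>+y. ennreal (c * y powr e) * indicator {a..b} y \<partial>lborel) =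
         ennreal (c * ((b powr (e + 1) - a powr (e + 1)) / (e + 1)))"
proof -
  have "(\<integral>\<^sup>+y. ennreal (c * y powr e) * indicator {a..b} y \<partial>lborel) =
        ennreal (c * b powr (e + 1) / (e + 1) - c * a powr (e + 1) / (e + 1))"
  proof (rule nn_integral_FTC_Icc)
    fix y assume "y \<in> {a..b}"
    then have "y > 0" using assms by auto
    then have "DERIV (\<lambda>y. c * y powr (e + 1) / (e + 1)) y :> c * ((e + 1) * y powr e) / (e + 1)"
      by (auto intro!: derivative_eq_intros)
    then show "DERIV (\<lambda>y. c * y powr (e + 1) / (e + 1)) y :> c * y powr e"
      using assms by simp
  qed (use assms in auto)
  then show ?thesis by (simp add: right_diff_distrib diff_divide_distrib)
qed

lemma nn_integral_powr_Ici:
  fixes a c e :: real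
  assumes "0 < a" "c \<ge> 0" "e < -1"
  shows "(\<integral>\<^sup>+y. ennreal (c * y powr e) * indicator {a..} y \<partial>lborel) =
         ennreal (c * (a powr (e + 1) / (- e - 1)))"
proof -
  have "(\<integral>\<^sup>+y. ennreal (c * y powr e) * indicator {a..} y \<partial>lborel) =
        ennreal (0 - c * a powr (e + 1) / (e + 1))"
  proof (rule nn_integral_FTC_atLeast)
    fix y assume "a \<le> y"
    then have "y > 0" using assms by auto
    then have "DERIV (\<lambda>y. c * y powr (e + 1) / (e + 1)) y :> c * ((e + 1) * y powr e) / (e + 1)"
      by (auto intro!: derivative_eq_intros)
    then show "DERIV (\<lambda>y. c * y powr (e + 1) / (e + 1)) y :> c * y powr e"
      using assms by simp
  next
    have "((\<lambda>y::real. y powr (e + 1)) \<longlongrightarrow> 0) at_top"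
      using assms by (intro tendsto_neg_powr filterlim_ident) auto
    from tendsto_mult_left[OF this, of "c / (e + 1)"]
    show "((\<lambda>y. c * y powr (e + 1) / (e + 1)) \<longlongrightarrow> 0) at_top" by simp
  qed (use assms in auto)
  moreover have "0 - c * a powr (e + 1) / (e + 1) = c * (a powr (e + 1) / (- e - 1))"
    using assms by (simp add: field_simps)
  ultimately show ?thesis by simp
qed

text \<open>The contribution of y \<ge> a to the mass seen by one large point, without the constant
  \<tau> - 1. Only the first \<open>j\<close> minima are kept: for increasing \<open>x\<close> and
  \<open>a = 1 / x (Suc j)\<close> the later ones equal 1 already, so \<open>j\<close> drops by one
  whenever \<open>a\<close> moves to the next cut.\<close>

definition edge_tail :: "real \<Rightarrow> (nat \<Rightarrow> real) \<Rightarrow> nat \<Rightarrow> real \<Rightarrow> ennreal" where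
  "edge_tail \<tau> x j a = (\<integral>\<^sup>+y. ennreal (y powr (- \<tau>) * (\<Prod>i=1..j. min 1 (x i * y))) * indicator {a..} y \<partial>lborel)"

text \<open>Cut at y = 1 / x (Suc j), where the first of the minima saturates. To the left every
  factor is x_i y and the integrand is a pure power; to the right the factor of the largest x_i is
  1.\<close>

lemma edge_tail_Suc:
  assumes "2 < \<tau>" "\<tau> < 3" and x: "\<And>i. i \<in> {1..Suc j} \<Longrightarrow> 0 < x i"
    and mono: "\<And>i. i \<in> {1..Suc j} \<Longrightarrow> x i \<le> x (Suc j)" and a: "0 < a" "a \<le> 1 / x (Suc j)"
  shows "edge_tail \<tau> x (Suc j) a =
    ennreal ((\<Prod>i=1..Suc j. x i) * (((1 / x (Suc j)) powr (real j + 2 - \<tau>) - a powr (real j + 2 - \<tau>)) / (real j + 2 - \<tau>)))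
    + edge_tail \<tau> x j (1 / x (Suc j))"
proof -
  define b where "b = 1 / x (Suc j)"
  define X where "X = (\<Prod>i=1..Suc j. x i)"
  have b: "0 < b" using x by (simp add: b_def)
  have X: "X > 0" unfolding X_def using x by (intro prod_pos) auto
  define g where "g j y = y powr (- \<tau>) * (\<Prod>i=1..j. min 1 (x i * y))" for j and y :: real
  have [measurable]: "g j \<in> borel_measurable borel" for j unfolding g_def by measurable
  \<comment> \<open>Both indicators are 1 at the cut itself, so this single point, a null set, is
    left out.\<close>
  have 1: "ennreal (g (Suc j) y) * indicator {a..} y =
        ennreal (X * y powr (real j + 1 - \<tau>)) * indicator {a..b} y + ennreal (g j y) * indicator {b..} y"
    if "y \<noteq> b" for y
  proof (cases "y < b")
    case True
    show ?thesis
    proof (cases "a \<le> y")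
      case ay: True
      then have y: "y > 0" using a by simp
      have "x i * y \<le> 1" if "i \<in> {1..Suc j}" for i
      proof -
        have "x i * y \<le> x (Suc j) * b"
          using True y x[OF that] mono[OF that] by (intro mult_mono) auto
        then show ?thesis using x[of "Suc j"] by (simp add: b_def)
      qed
      then have "(\<Prod>i=1..Suc j. min 1 (x i * y)) = (\<Prod>i=1..Suc j. x i * y)"
        by (intro prod.cong refl min_absorb2)
      also have "\<dots> = X * y ^ Suc j" by (simp only: prod.distrib X_def prod_constant) simp
      finally have "g (Suc j) y = X * (y powr (- \<tau>) * y ^ Suc j)" by (simp only: g_def mult_ac)
      also have "y powr (- \<tau>) * y ^ Suc j = y powr (real j + 1 - \<tau>)"
        using y by (subst powr_realpow[symmetric]) (simp_all add: powr_add[symmetric] algebra_simps)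
      finally show ?thesis using ay True by simp
    qed (use True in auto)
  next
    case False
    then have y: "y > b" using that by simp
    then have "1 \<le> x (Suc j) * y" using x[of "Suc j"] by (simp add: b_def field_simps)
    then have "g (Suc j) y = g j y" by (simp add: g_def)
    then show ?thesis using y a by (simp add: b_def)
  qed
  have "edge_tail \<tau> x (Suc j) a = (\<integral>\<^sup>+y. ennreal (g (Suc j) y) * indicator {a..} y \<partial>lborel)"
    by (simp only: edge_tail_def g_def)
  also have "\<dots> = (\<integral>\<^sup>+y. ennreal (X * y powr (real j + 1 - \<tau>)) * indicator {a..b} y + ennreal (g j y) * indicator {b..} y \<partial>lborel)"
    by (intro nn_integral_cong_AE eventually_mono[OF AE_lborel_singleton[of b]] 1)
  also have "\<dots> = (\<integral>\<^sup>+y. ennreal (X * y powr (real j + 1 - \<tau>)) * indicator {a..b} y \<partial>lborel) + edge_tail \<tau> x j b"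
    unfolding edge_tail_def g_def[symmetric] by (intro nn_integral_add) measurable
  also have "(\<integral>\<^sup>+y. ennreal (X * y powr (real j + 1 - \<tau>)) * indicator {a..b} y \<partial>lborel) =
     ennreal (X * ((b powr (real j + 1 - \<tau> + 1) - a powr (real j + 1 - \<tau> + 1)) / (real j + 1 - \<tau> + 1)))"
  proof (rule nn_integral_powr_Icc)
    \<comment> \<open>The exponent j + 1 - \<tau> must differ from -1. It does because \<tau> lies
      strictly between 2 and 3, so no logarithm arises.\<close>
    have "real j \<noteq> \<tau> - 2"
    proof
      assume "real j = \<tau> - 2"
      then have "0 < j" "j < 1" using assms(1,2) by linarith+
      then show False by simp
    qed
    then show "real j + 1 - \<tau> \<noteq> - 1" by simp
  qed (use a b X in \<open>auto simp: b_def\<close>)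
  also have "real j + 1 - \<tau> + 1 = real j + 2 - \<tau>" by simp
  finally show ?thesis unfolding b_def X_def .
qed

text \<open>
  This is \<open>x\<^sub>1 \<cdots> x\<^sub>j x\<^bsub>j+1\<^esub>\<^bsup>\<tau>-1-j\<^esup>\<close> for \<open>x\<^sub>i = t\<^sub>i \<cdots> t\<^sub>m\<close> and \<open>x\<^bsub>m+1\<^esub> = 1\<close>: up to a factor
  \<open>j + 1 - \<tau>\<close> or \<open>j + 2 - \<tau>\<close>, the boundary value at \<open>y = 1 / x\<^bsub>j+1\<^esub>\<close> of an
  antiderivative of the integrand of \<open>edge_tail\<close>.
\<close>

definition edge_term :: "real \<Rightarrow> nat \<Rightarrow> (nat \<Rightarrow> real) \<Rightarrow> nat \<Rightarrow> real" where
  "edge_term \<tau> m t j = (\<Prod>i=1..m. t i powr (\<tau> - 1)) * (\<Prod>i=1..j. t i powr (real i + 1 - \<tau>))"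

text \<open>Lowering \<open>j\<close> to 0 leaves the tail of y^(-\<tau>) beyond 1/x_1, which is
  x_1^(\<tau>-1) / (\<tau>-1); each interval on the way adds a difference of boundary values.
  Nonnegativity runs through the same induction because the partial sums are merged inside
  \<open>ennreal\<close>.\<close>

lemma edge_tail_eq:
  fixes t :: "nat \<Rightarrow> real"
  assumes \<tau>: "2 < \<tau>" "\<tau> < 3" and t: "\<And>i. i \<in> {1..m} \<Longrightarrow> 0 < t i \<and> t i \<le> 1" and "j \<le> m"
  defines "x \<equiv> \<lambda>i. \<Prod>l=i..m. t l"
  shows "edge_tail \<tau> x j (1 / x (Suc j)) =
     ennreal (edge_term \<tau> m t 0 / (\<tau> - 1) +
       (\<Sum>i=1..j. (edge_term \<tau> m t (i - 1) - edge_term \<tau> m t i) / (real i + 1 - \<tau>)))"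
    and "0 \<le> edge_term \<tau> m t 0 / (\<tau> - 1) +
       (\<Sum>i=1..j. (edge_term \<tau> m t (i - 1) - edge_term \<tau> m t i) / (real i + 1 - \<tau>))"
proof -
  have x_pos: "0 < x i" if "1 \<le> i" for i
    unfolding x_def using t that by (intro prod_pos) auto
  have x_step: "x i = t i * x (Suc i)" if "i \<in> {1..m}" for i
    unfolding x_def using that by (simp add: prod.atLeast_Suc_atMost)
  have x_mono: "x i \<le> x i'" if "1 \<le> i" "i \<le> i'" for i i'
  proof -
    have "x i \<le> x (Suc i)" if "1 \<le> i" for i
    proof (cases "i \<le> m")
      case True
      then show ?thesis using x_step[of i] t[of i] x_pos[of "Suc i"] that by (simp add: mult_left_le_one_le)
    next
      case False
      then show ?thesis by (simp add: x_def)
    qed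
    with that(2,1) show ?thesis
      by (induction rule: dec_induct) (auto intro: order_trans)
  qed
  have R0: "edge_term \<tau> m t 0 = x 1 powr (\<tau> - 1)"
    unfolding edge_term_def x_def using t by (simp add: prod_powr_distrib)
  \<comment> \<open>From j to j + 1 the product gains x_(j+1) and the evaluation moves from x_(j+1)
    to x_(j+2). As x_(j+1) = t_(j+1) x_(j+2), all that remains of the change is the power j + 2 -
    \<tau> of t_(j+1).\<close>
  have R: "(\<Prod>i=1..j. x i) * x (Suc j) powr (\<tau> - 1 - real j) = edge_term \<tau> m t j" if "j \<le> m" for j
    using that
  proof (induction j)
    case 0
    then show ?case by (simp add: R0)
  next
    case (Suc j)
    let ?s = "x (Suc (Suc j))"
    have s: "0 < ?s" "0 < t (Suc j)" using x_pos t[of "Suc j"] Suc.prems by auto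
    have eq: "x (Suc j) = t (Suc j) * ?s" using x_step[of "Suc j"] Suc.prems by simp
    have "x (Suc j) * ?s powr (\<tau> - 1 - real (Suc j)) = t (Suc j) * ?s powr (\<tau> - 1 - real j)"
    proof -
      have "?s * ?s powr (\<tau> - 1 - real (Suc j)) = ?s powr (\<tau> - 1 - real j)"
        using s by (subst powr_mult_base) (auto simp: algebra_simps)
      then show ?thesis unfolding eq by (simp only: mult.assoc)
    qed
    also have "\<dots> = x (Suc j) powr (\<tau> - 1 - real j) * t (Suc j) powr (real (Suc j) + 1 - \<tau>)"
    proof -
      have "t (Suc j) = t (Suc j) powr (\<tau> - 1 - real j) * t (Suc j) powr (real (Suc j) + 1 - \<tau>)"
        using s by (simp add: powr_add[symmetric])
      then show ?thesis using s unfolding eq by (simp add: powr_mult)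
    qed
    finally have "(\<Prod>i=1..Suc j. x i) * ?s powr (\<tau> - 1 - real (Suc j)) =
        (\<Prod>i=1..j. x i) * x (Suc j) powr (\<tau> - 1 - real j) * t (Suc j) powr (real (Suc j) + 1 - \<tau>)"
      by (simp add: mult.assoc)
    also have "\<dots> = edge_term \<tau> m t j * t (Suc j) powr (real (Suc j) + 1 - \<tau>)"
      using Suc by simp
    also have "\<dots> = edge_term \<tau> m t (Suc j)"
      unfolding edge_term_def by (simp add: mult.assoc)
    finally show ?case .
  qed
  have term_pos: "0 < edge_term \<tau> m t j" if "j \<le> m" for j
    unfolding edge_term_def using t that by (intro mult_pos_pos prod_pos) fastforce+
  have step: "(\<Prod>i=1..Suc j. x i) * ((1 / x (Suc j)) powr (real j + 2 - \<tau>) - (1 / x (Suc (Suc j))) powr (real j + 2 - \<tau>))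
     = edge_term \<tau> m t j - edge_term \<tau> m t (Suc j)" if "Suc j \<le> m" for j
  proof -
    have pos: "0 < x (Suc j)" "0 < x (Suc (Suc j))" using x_pos by auto
    have inv: "(1 / y) powr (real j + 2 - \<tau>) = y powr (\<tau> - 1 - real (Suc j))" if "0 < y" for y :: real
      using that powr_minus[of y "real j + 2 - \<tau>"] by (simp add: powr_divide inverse_eq_divide algebra_simps)
    have "x (Suc j) * x (Suc j) powr (\<tau> - 1 - real (Suc j)) = x (Suc j) powr (\<tau> - 1 - real j)"
      using pos by (subst powr_mult_base) (auto simp: algebra_simps)
    then have "(\<Prod>i=1..Suc j. x i) * x (Suc j) powr (\<tau> - 1 - real (Suc j)) = edge_term \<tau> m t j"
      using R[of j] that by (simp add: mult.assoc)
    then show ?thesis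
      unfolding right_diff_distrib inv[OF pos(1)] inv[OF pos(2)] R[OF that] by simp
  qed
  have "edge_tail \<tau> x j (1 / x (Suc j)) =
     ennreal (edge_term \<tau> m t 0 / (\<tau> - 1) +
       (\<Sum>i=1..j. (edge_term \<tau> m t (i - 1) - edge_term \<tau> m t i) / (real i + 1 - \<tau>))) \<and> 0 \<le> edge_term \<tau> m t 0 / (\<tau> - 1) +
       (\<Sum>i=1..j. (edge_term \<tau> m t (i - 1) - edge_term \<tau> m t i) / (real i + 1 - \<tau>))"
    using \<open>j \<le> m\<close>
  proof (induction j)
    case 0
    have "edge_tail \<tau> x 0 (1 / x 1) = ennreal (1 * ((1 / x 1) powr (- \<tau> + 1) / (- (- \<tau>) - 1)))"
      using nn_integral_powr_Ici[of "1 / x 1" 1 "- \<tau>"] x_pos[of 1] \<tau> by (simp add: edge_tail_def)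
    also have "(1 / x 1) powr (- \<tau> + 1) = x 1 powr (\<tau> - 1)"
      using x_pos[of 1] powr_minus[of "x 1" "- \<tau> + 1"] by (simp add: powr_divide inverse_eq_divide)
    finally show ?case using R0 \<tau> by simp
  next
    case (Suc j)
    let ?S = "edge_term \<tau> m t 0 / (\<tau> - 1) +
       (\<Sum>i=1..j. (edge_term \<tau> m t (i - 1) - edge_term \<tau> m t i) / (real i + 1 - \<tau>))"
    let ?D = "(edge_term \<tau> m t j - edge_term \<tau> m t (Suc j)) / (real (Suc j) + 1 - \<tau>)"
    have IH: "edge_tail \<tau> x j (1 / x (Suc j)) = ennreal ?S" "0 \<le> ?S"
      using Suc by auto
    have "edge_tail \<tau> x (Suc j) (1 / x (Suc (Suc j))) =
     ennreal ((\<Prod>i=1..Suc j. x i) * (((1 / x (Suc j)) powr (real j + 2 - \<tau>) -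
        (1 / x (Suc (Suc j))) powr (real j + 2 - \<tau>)) / (real j + 2 - \<tau>))) +
     edge_tail \<tau> x j (1 / x (Suc j))"
    proof (rule edge_tail_Suc[OF \<tau>])
      show "1 / x (Suc (Suc j)) \<le> 1 / x (Suc j)"
        using x_pos x_mono[of "Suc j" "Suc (Suc j)"] by (intro divide_left_mono mult_pos_pos) auto
    qed (use x_pos x_mono in auto)
    also have "(\<Prod>i=1..Suc j. x i) * (((1 / x (Suc j)) powr (real j + 2 - \<tau>) -
        (1 / x (Suc (Suc j))) powr (real j + 2 - \<tau>)) / (real j + 2 - \<tau>)) = ?D"
      using step[OF Suc.prems] by (simp add: add_ac)
    finally have eq: "edge_tail \<tau> x (Suc j) (1 / x (Suc (Suc j))) = ennreal ?D + ennreal ?S"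
      using IH(1) by simp
    \<comment> \<open>The first difference is special: its denominator 2 - \<tau> is negative, but
      t_1^(2-\<tau>) \<ge> 1 makes its numerator nonpositive as well. From the second on, numerator
      and denominator are both nonnegative.\<close>
    have "0 \<le> ?D"
    proof -
      have *: "edge_term \<tau> m t (Suc j) = edge_term \<tau> m t j * t (Suc j) powr (real (Suc j) + 1 - \<tau>)"
        unfolding edge_term_def by (simp add: mult.assoc)
      have tj: "0 < t (Suc j)" "t (Suc j) \<le> 1" using t[of "Suc j"] Suc.prems by auto
      have pos: "0 < edge_term \<tau> m t j" using term_pos[of j] Suc.prems by simp
      show ?thesis
      proof (cases j)
        case 0
        have "1 \<le> t (Suc j) powr (real (Suc j) + 1 - \<tau>)"
          using tj powr_mono'[of "real (Suc j) + 1 - \<tau>" 0 "t (Suc j)"] \<tau> 0 by simp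
        then have "edge_term \<tau> m t j \<le> edge_term \<tau> m t (Suc j)"
          unfolding * using pos by simp
        then show ?thesis using \<tau> 0 by (intro divide_nonpos_nonpos) auto
      next
        case (Suc i)
        have "t (Suc j) powr (real (Suc j) + 1 - \<tau>) \<le> 1"
          using tj \<tau> Suc by (intro powr_le1) auto
        then have "edge_term \<tau> m t (Suc j) \<le> edge_term \<tau> m t j"
          unfolding * using pos by (simp add: mult_left_le)
        then show ?thesis using \<tau> Suc by (intro divide_nonneg_nonneg) auto
      qed
    qed
    then show ?case using IH(2) eq by (simp add: ennreal_plus[symmetric] add_ac)
  qed
  then show "edge_tail \<tau> x j (1 / x (Suc j)) =
     ennreal (edge_term \<tau> m t 0 / (\<tau> - 1) +
       (\<Sum>i=1..j. (edge_term \<tau> m t (i - 1) - edge_term \<tau> m t i) / (real i + 1 - \<tau>)))"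
    "0 \<le> edge_term \<tau> m t 0 / (\<tau> - 1) +
       (\<Sum>i=1..j. (edge_term \<tau> m t (i - 1) - edge_term \<tau> m t i) / (real i + 1 - \<tau>))"
    by blast+
qed

text \<open>Collect the coefficient of each R_j. For R_1 it is 1/(\<tau>-2) + 1/(3-\<tau>); for
  R_(j-1) with j \<ge> 3 it is 1/(j+1-\<tau>) - 1/(j-\<tau>) = -1/((j+1-\<tau>)(j-\<tau>)). Up to
  the factor \<tau> - 1 these are the coefficients in \<Phi>_m.\<close>

lemma sum_diff_summation_by_parts:
  fixes R :: "nat \<Rightarrow> real"
  assumes "2 < \<tau>" "\<tau> < 3" "2 \<le> n"
  shows "(\<Sum>i=1..n. (R (i - 1) - R i) / (real i + 1 - \<tau>)) =
    - R 0 / (\<tau> - 2) + R 1 / ((3 - \<tau>) * (\<tau> - 2))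
    - (\<Sum>j=3..n. R (j - 1) / ((real j + 1 - \<tau>) * (real j - \<tau>))) - R n / (real n + 1 - \<tau>)"
  using assms(3)
proof (induction rule: nat_induct_at_least)
  case base
  have "{1..2::nat} = {1, 2}" by auto
  moreover have "R 1 / ((3 - \<tau>) * (\<tau> - 2)) = R 1 / (\<tau> - 2) + R 1 / (3 - \<tau>)"
    using assms(1,2) by (simp add: divide_simps) (simp add: algebra_simps)
  moreover have "(R 0 - R 1) / (2 - \<tau>) = - ((R 0 - R 1) / (\<tau> - 2))"
    using minus_divide_right[of "R 0 - R 1" "\<tau> - 2"] by simp
  ultimately show ?case by (simp add: diff_divide_distrib)
next
  case (Suc n)
  have "R n / (real n + 1 - \<tau>) - R n / ((real n + 2 - \<tau>) * (real n + 1 - \<tau>)) = R n / (real n + 2 - \<tau>)"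
    using assms(2) Suc.hyps by (simp add: divide_simps) (simp add: algebra_simps)
  moreover have "{3..Suc n} = insert (Suc n) {3..n}" using Suc.hyps by auto
  ultimately show ?case
    using Suc.IH by (simp add: diff_divide_distrib add_ac)
qed

text \<open>At m = 2 the sum over \<open>{3..m}\<close> is empty and the products have one factor,
  so that branch is an instance of the general one.\<close>

lemma Phi_eq_prod:
  assumes "2 \<le> m"
  shows "Phi \<tau> m t = t 1 * (\<Prod>i=2..m. t i powr (\<tau> - 1)) *
         ((\<tau> - 1) / ((3 - \<tau>) * (\<tau> - 2)) - t 1 powr (\<tau> - 2) / (\<tau> - 2)
          - (\<Sum>j=3..m. (\<tau> - 1) / ((real j + 1 - \<tau>) * (real j - \<tau>)) *
                        (\<Prod>i=2..j-1. t i powr (real i + 1 - \<tau>)))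
          - (\<tau> - 1) / (real m + 1 - \<tau>) * (\<Prod>i=2..m. t i powr (real i + 1 - \<tau>)))"
  using assms by (cases "m = 2") (auto simp: Phi_def)

text \<open>R_1 = t_1 t_2^(\<tau>-1) ... t_m^(\<tau>-1) is the prefactor of \<Phi>_m and divides
  every boundary value: the quotients R_j / R_1 are the partial products in the bracket, and R_0 /
  R_1 = t_1^(\<tau>-2). The case m = 1 is separate because the summation by parts needs two
  terms.\<close>

lemma Phi_eq_edge_terms:
  assumes \<tau>: "2 < \<tau>" "\<tau> < 3" and t: "\<And>i. i \<in> {1..m} \<Longrightarrow> 0 < t i" and m: "1 \<le> m"
  shows "Phi \<tau> m t = (\<tau> - 1) * (edge_term \<tau> m t 0 / (\<tau> - 1) +
       (\<Sum>i=1..m. (edge_term \<tau> m t (i - 1) - edge_term \<tau> m t i) / (real i + 1 - \<tau>)))"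
proof -
  define R where "R = edge_term \<tau> m t"
  define P where "P j = (\<Prod>i=2..j. t i powr (real i + 1 - \<tau>))" for j
  have t1: "0 < t 1" using t m by auto
  have split: "(\<Prod>i=1..j. f i) = f 1 * (\<Prod>i=2..j. f i)" if "1 \<le> j" for f :: "nat \<Rightarrow> real" and j
    using that by (simp add: prod.atLeast_Suc_atMost numeral_2_eq_2)
  have R0: "R 0 = t 1 powr (\<tau> - 1) * (\<Prod>i=2..m. t i powr (\<tau> - 1))"
    unfolding R_def edge_term_def split[OF m] by simp
  have Rj: "R j = t 1 * (\<Prod>i=2..m. t i powr (\<tau> - 1)) * P j" if "1 \<le> j" for j
  proof -
    have "t 1 powr (\<tau> - 1) * t 1 powr (2 - \<tau>) = t 1"
      using t1 by (simp add: powr_add[symmetric])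
    then show ?thesis
      unfolding R_def edge_term_def split[OF m] split[OF that] P_def by (simp add: mult_ac)
  qed
  have R0': "R 0 = R 1 * t 1 powr (\<tau> - 2)"
  proof -
    have "t 1 powr (\<tau> - 1) = t 1 * t 1 powr (\<tau> - 2)"
      using t1 by (subst powr_mult_base) (auto simp: algebra_simps)
    then show ?thesis unfolding R0 Rj[OF order_refl] P_def by simp
  qed
  have Rj': "R j = R 1 * P j" if "1 \<le> j" for j
    using Rj[OF that] Rj[of 1] by (simp add: P_def)
  have R1: "R 1 = t 1 * (\<Prod>i=2..m. t i powr (\<tau> - 1))"
    using Rj[of 1] by (simp add: P_def)
  show ?thesis
  proof (cases "m = 1")
    case True
    then have "Phi \<tau> m t = R 1 * ((\<tau> - 1) / (\<tau> - 2) - t 1 powr (\<tau> - 2) / (\<tau> - 2))"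
      unfolding R1 by (simp add: Phi_def)
    also have "\<dots> = (\<tau> - 1) * (R 0 / (\<tau> - 1) + (R 0 - R 1) / (2 - \<tau>))"
    proof -
      define s where "s = \<tau> - 2"
      have s: "\<tau> = s + 2" "s \<noteq> 0" "s + 1 \<noteq> 0" using \<tau> by (auto simp: s_def)
      show ?thesis unfolding R0' unfolding s(1) using s(2,3)
        by (simp add: divide_simps) (simp add: algebra_simps)
    qed
    finally show ?thesis using True by (simp add: R_def)
  next
    case False
    then have m2: "2 \<le> m" using m by simp
    have "Phi \<tau> m t = R 1 *
         ((\<tau> - 1) / ((3 - \<tau>) * (\<tau> - 2)) - t 1 powr (\<tau> - 2) / (\<tau> - 2)
          - (\<Sum>j=3..m. (\<tau> - 1) / ((real j + 1 - \<tau>) * (real j - \<tau>)) * P (j - 1))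
          - (\<tau> - 1) / (real m + 1 - \<tau>) * P m)"
      unfolding Phi_eq_prod[OF m2] R1 P_def ..
    also have "\<dots> = (\<tau> - 1) / ((3 - \<tau>) * (\<tau> - 2)) * R 1 - R 0 / (\<tau> - 2)
          - (\<Sum>j=3..m. (\<tau> - 1) * (R (j - 1) / ((real j + 1 - \<tau>) * (real j - \<tau>))))
          - (\<tau> - 1) / (real m + 1 - \<tau>) * R m"
    proof -
      have "R 1 * (\<Sum>j=3..m. (\<tau> - 1) / ((real j + 1 - \<tau>) * (real j - \<tau>)) * P (j - 1)) =
          (\<Sum>j=3..m. (\<tau> - 1) * (R (j - 1) / ((real j + 1 - \<tau>) * (real j - \<tau>))))"
        unfolding sum_distrib_left by (intro sum.cong refl, subst Rj') auto
      moreover have "R 1 * ((\<tau> - 1) / (real m + 1 - \<tau>) * P m) = (\<tau> - 1) / (real m + 1 - \<tau>) * R m"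
        unfolding Rj'[OF m] by (simp only: mult_ac)
      moreover have "R 1 * (t 1 powr (\<tau> - 2) / (\<tau> - 2)) = R 0 / (\<tau> - 2)"
        unfolding R0' by simp
      moreover define A where "A = (\<tau> - 1) / ((3 - \<tau>) * (\<tau> - 2))"
      ultimately show ?thesis
        unfolding A_def[symmetric] by (simp only: right_diff_distrib mult.commute[of "R 1" A])
    qed
    \<comment> \<open>On the right R_0 occurs with coefficient 1 from the tail and
      -(\<tau>-1)/(\<tau>-2) from the sum, together -1/(\<tau>-2).\<close>
    also have "\<dots> = (\<tau> - 1) * (R 0 / (\<tau> - 1) + (\<Sum>i=1..m. (R (i - 1) - R i) / (real i + 1 - \<tau>)))"
    proof -
      have "R 0 / (\<tau> - 2) * (\<tau> - 1) = R 0 / (\<tau> - 2) + R 0"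
        using \<tau> by (simp add: field_simps)
      moreover have "(\<tau> * R 0 - R 0) / (\<tau> - 1) = R 0"
        using \<tau> by (simp add: divide_simps) (simp add: algebra_simps)
      ultimately show ?thesis
        unfolding sum_diff_summation_by_parts[OF \<tau> m2] sum_distrib_left[symmetric]
        using \<tau> by (simp add: algebra_simps)
    qed
    finally show ?thesis by (simp add: R_def)
  qed
qed

text \<open>The lower limit 1 is 1 / x (Suc m), since x (Suc m) is an empty product. The sign of
  \<Phi>_m is hidden by the subtractions in its formula and is read off from the sum of boundary
  differences instead.\<close>

lemma edge_tail_Phi:
  assumes \<tau>: "2 < \<tau>" "\<tau> < 3" and t: "\<And>i. i \<in> {1..m} \<Longrightarrow> 0 < t i \<and> t i \<le> 1" and m: "1 \<le> m"
  shows "ennreal (\<tau> - 1) * edge_tail \<tau> (\<lambda>i. \<Prod>l=i..m. t l) m 1 = ennreal (Phi \<tau> m t)"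
    and "0 \<le> Phi \<tau> m t"
proof -
  have Phi: "Phi \<tau> m t = (\<tau> - 1) * (edge_term \<tau> m t 0 / (\<tau> - 1) +
       (\<Sum>i=1..m. (edge_term \<tau> m t (i - 1) - edge_term \<tau> m t i) / (real i + 1 - \<tau>)))"
    using t m by (intro Phi_eq_edge_terms \<tau>) auto
  show "0 \<le> Phi \<tau> m t"
    unfolding Phi using edge_tail_eq(2)[where m = m and t = t and j = m, OF \<tau> t] \<tau> by (intro mult_nonneg_nonneg) auto
  show "ennreal (\<tau> - 1) * edge_tail \<tau> (\<lambda>i. \<Prod>l=i..m. t l) m 1 = ennreal (Phi \<tau> m t)"
    unfolding Phi using edge_tail_eq[where m = m and t = t and j = m, OF \<tau> t] \<tau> by (simp add: ennreal_mult)
qed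

text \<open>All subtracted terms are nonnegative and are dropped; for m = 1 the constant is enlarged
  by 1/(3-\<tau>) > 1, so that one bound serves every m. It supplies the majorant for the
  integrability of \<open>J\<close>.\<close>

lemma Phi_upper_bound:
  assumes \<tau>: "2 < \<tau>" "\<tau> < 3" and t: "\<And>i. i \<in> {1..m} \<Longrightarrow> 0 < t i" and m: "1 \<le> m"
  shows "Phi \<tau> m t \<le> (\<tau> - 1) / ((3 - \<tau>) * (\<tau> - 2)) * (t 1 * (\<Prod>i=2..m. t i powr (\<tau> - 1)))"
proof (cases "m = 1")
  case True
  have "(\<tau> - 1) / (\<tau> - 2) \<le> (\<tau> - 1) / ((3 - \<tau>) * (\<tau> - 2))"
    using \<tau> by (intro divide_left_mono) auto
  then have "(\<tau> - 1) / (\<tau> - 2) - t 1 powr (\<tau> - 2) / (\<tau> - 2) \<le> (\<tau> - 1) / ((3 - \<tau>) * (\<tau> - 2))"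
    using \<tau> by (smt (verit) divide_nonneg_pos powr_ge_zero)
  then have "t 1 * ((\<tau> - 1) / (\<tau> - 2) - t 1 powr (\<tau> - 2) / (\<tau> - 2)) \<le> t 1 * ((\<tau> - 1) / ((3 - \<tau>) * (\<tau> - 2)))"
    using t[of 1] m by (intro mult_left_mono) auto
  then show ?thesis using True by (simp add: Phi_def mult_ac)
next
  case False
  then have m2: "2 \<le> m" using m by simp
  have "0 \<le> t 1 powr (\<tau> - 2) / (\<tau> - 2)" using \<tau> by simp
  moreover have "0 \<le> (\<Sum>j=3..m. (\<tau> - 1) / ((real j + 1 - \<tau>) * (real j - \<tau>)) *
                        (\<Prod>i=2..j-1. t i powr (real i + 1 - \<tau>)))"
    using \<tau> by (intro sum_nonneg mult_nonneg_nonneg divide_nonneg_nonneg prod_nonneg) auto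
  moreover have "0 \<le> (\<tau> - 1) / (real m + 1 - \<tau>) * (\<Prod>i=2..m. t i powr (real i + 1 - \<tau>))"
    using \<tau> m2 by (intro mult_nonneg_nonneg divide_nonneg_nonneg prod_nonneg) auto
  ultimately show ?thesis
    unfolding Phi_eq_prod[OF m2] mult.commute[of "(\<tau> - 1) / ((3 - \<tau>) * (\<tau> - 2))"]
    using t[of 1] m by (intro mult_left_mono mult_nonneg_nonneg prod_nonneg) auto
qed

subsection \<open>Products over pairs\<close>

text \<open>Clipping at \<open>0\<close> matches \<^const>\<open>bernoulli_pmf\<close>, whose parameter is clipped to \<open>[0, 1]\<close>.\<close>

definition clip :: "real \<Rightarrow> real" where "clip z = min 1 (max 0 z)"

lemma clip_measurable [measurable]: "clip \<in> borel_measurable borel"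
  unfolding clip_def by measurable

text \<open>The conditional probability that \<open>I\<close> is a clique, given the weights
  \<gamma>_n x. A product over two-element subsets needs no order on the vertices and is transported
  by any bijection of them.\<close>

definition pair_prod :: "nat set \<Rightarrow> (nat \<Rightarrow> real) \<Rightarrow> real" where
  "pair_prod I x = (\<Prod>e\<in>[I]\<^bsup>2\<^esup>. clip (\<Prod>i\<in>e. x i))"

lemma pair_prod_empty [simp]: "pair_prod {} x = 1"
  by (simp add: pair_prod_def nsets_empty_iff)

lemma pair_prod_cong: "(\<And>i. i \<in> I \<Longrightarrow> x i = y i) \<Longrightarrow> pair_prod I x = pair_prod I y"
  unfolding pair_prod_def nsets_def
  by (intro prod.cong refl arg_cong[of _ _ clip]) auto

lemma pair_prod_measurable [measurable]:
  "finite I \<Longrightarrow> pair_prod I \<in> borel_measurable (Pi\<^sub>M I (\<lambda>_. lborel))"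
  unfolding pair_prod_def
  by (intro borel_measurable_prod measurable_compose[OF _ clip_measurable]) (auto simp: nsets_def)

lemma pair_prod_insert:
  assumes "finite I" "a \<notin> I"
  shows "pair_prod (insert a I) x = pair_prod I x * (\<Prod>i\<in>I. clip (x a * x i))"
proof -
  have "[insert a I]\<^bsup>2\<^esup> = [I]\<^bsup>2\<^esup> \<union> (\<lambda>i. {a, i}) ` I"
    using assms by (auto simp: nsets_2_eq)
  moreover have "[I]\<^bsup>2\<^esup> \<inter> (\<lambda>i. {a, i}) ` I = {}"
    using assms by (auto simp: nsets_def)
  moreover have "inj_on (\<lambda>i. {a, i}) I"
    by (auto simp: inj_on_def doubleton_eq_iff)
  moreover have "(\<Prod>l\<in>{a, i}. x l) = x a * x i" if "i \<in> I" for i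
    using assms that by (cases "a = i") auto
  ultimately show ?thesis
    unfolding pair_prod_def using assms
    by (simp add: prod.union_disjoint finite_imp_finite_nsets prod.reindex)
qed

text \<open>No product of two points exceeds 1, so nothing is clipped, and each point lies in
  \<open>card I - 1\<close> pairs.\<close>

lemma pair_prod_small:
  assumes "finite I" "\<And>i. i \<in> I \<Longrightarrow> 0 < x i \<and> x i \<le> 1"
  shows "pair_prod I x = (\<Prod>i\<in>I. x i ^ (card I - 1))"
  using assms
proof (induction rule: finite_induct)
  case (insert a I)
  have clip: "clip (x a * x i) = x a * x i" if "i \<in> I" for i
  proof -
    have "0 < x a * x i" "x a * x i \<le> 1"
      using insert.prems[of a] insert.prems[of i] that by (auto intro: mult_le_one)
    then show ?thesis by (simp add: clip_def)
  qed
  have "pair_prod (insert a I) x = (\<Prod>i\<in>I. x i ^ (card I - 1)) * (\<Prod>i\<in>I. x a * x i)"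
    using insert by (simp add: pair_prod_insert clip)
  also have "\<dots> = x a ^ card I * (\<Prod>i\<in>I. x i ^ (card I - 1) * x i)"
    by (simp add: prod.distrib mult_ac)
  also have "(\<Prod>i\<in>I. x i ^ (card I - 1) * x i) = (\<Prod>i\<in>I. x i ^ card I)"
    using insert.hyps by (intro prod.cong refl power_minus_mult) (auto simp: card_gt_0_iff)
  finally show ?case using insert.hyps by simp
qed simp

lemma pair_prod_Un:
  assumes "finite T" "finite U" "T \<inter> U = {}"
    and small: "\<And>i. i \<in> T \<Longrightarrow> 0 < x i \<and> x i \<le> 1" and large: "\<And>i. i \<in> U \<Longrightarrow> 1 < x i"
  shows "pair_prod (T \<union> U) x = (\<Prod>i\<in>T. x i ^ (card T - 1)) * (\<Prod>u\<in>U. \<Prod>i\<in>T. min 1 (x i * x u))"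
  using assms(2,3,5)
proof (induction rule: finite_induct)
  case empty
  then show ?case using pair_prod_small[OF assms(1) small] by simp
next
  case (insert u U)
  have xu: "1 < x u" using insert.prems by auto
  have "(\<Prod>i\<in>U. clip (x u * x i)) = 1"
  proof (intro prod.neutral ballI)
    fix i assume "i \<in> U"
    then have "1 < x u * x i" using xu insert.prems(2)[of i] by (intro less_1_mult) auto
    then show "clip (x u * x i) = 1" by (simp add: clip_def)
  qed
  moreover have "(\<Prod>i\<in>T. clip (x u * x i)) = (\<Prod>i\<in>T. min 1 (x i * x u))"
  proof (intro prod.cong refl)
    fix i assume "i \<in> T"
    then have "0 < x i * x u" using small[of i] xu by simp
    then show "clip (x u * x i) = min 1 (x i * x u)" by (simp add: clip_def mult.commute)
  qed
  ultimately have "(\<Prod>i\<in>T \<union> U. clip (x u * x i)) = (\<Prod>i\<in>T. min 1 (x i * x u))"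
    using insert.prems(1) insert.hyps assms(1) by (simp add: prod.union_disjoint)
  moreover have "pair_prod (T \<union> insert u U) x = pair_prod (T \<union> U) x * (\<Prod>i\<in>T \<union> U. clip (x u * x i))"
    using insert.prems(1) insert.hyps assms(1) by (simp add: pair_prod_insert)
  ultimately show ?case
    using insert by (simp add: mult_ac)
qed

subsection \<open>Splitting into small and large points\<close>

text \<open>The limit of the density of \<open>H / \<gamma>\<^sub>n\<close>, divided by \<open>\<gamma>\<^sub>n\<^bsup>1-\<tau>\<^esup>\<close>.\<close>

definition scaled_density :: "real \<Rightarrow> real \<Rightarrow> real" where
  "scaled_density \<tau> y = (if 0 < y then (\<tau> - 1) * y powr (- \<tau>) else 0)"

lemma scaled_density_measurable [measurable]: "scaled_density \<tau> \<in> borel_measurable borel"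
  unfolding scaled_density_def by measurable

text \<open>The integral over a single large point, given the small points \<open>M\<close>. The
  argument is a multiset because the sorting lemma is stated for functions of multisets.\<close>

definition link_mass :: "real \<Rightarrow> real multiset \<Rightarrow> ennreal" where
  "link_mass \<tau> M = (\<integral>\<^sup>+y. (ennreal (scaled_density \<tau> y) * indicator {1<..} y) *
      (\<Prod>x\<in>#M. ennreal (min 1 (x * y))) \<partial>lborel)"

text \<open>What is left on m small points once \<open>r\<close> large ones are integrated out. The
  exponent is -\<tau> from the density plus m - 1 from the pairs with the other small
  points.\<close>

definition small_weight :: "real \<Rightarrow> nat \<Rightarrow> nat \<Rightarrow> real multiset \<Rightarrow> ennreal" where
  "small_weight \<tau> m r M = (\<Prod>x\<in>#M. ennreal ((\<tau> - 1) * x powr (real m - 1 - \<tau>))) * link_mass \<tau> M ^ r"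

lemma prod_mset_image_mset_set:
  "(\<Prod>y\<in>#image_mset x (mset_set T). f y) = (\<Prod>i\<in>T. f (x i))"
  by (simp add: prod_unfold_prod_mset image_mset.compositionality o_def)

lemma prod_components_measurable:
  fixes f :: "real \<Rightarrow> ennreal" and T K :: "nat set"
  assumes "T \<subseteq> K" and [measurable]: "f \<in> borel_measurable borel"
  shows "(\<lambda>x. \<Prod>i\<in>T. f (x i)) \<in> borel_measurable (Pi\<^sub>M K (\<lambda>_. lborel))"
proof (rule borel_measurable_prod_ennreal)
  fix i assume "i \<in> T"
  then have "(\<lambda>x. x i) \<in> Pi\<^sub>M K (\<lambda>_. lborel) \<rightarrow>\<^sub>M lborel"
    using assms(1) by (intro measurable_component_singleton) auto
  then show "(\<lambda>x. f (x i)) \<in> borel_measurable (Pi\<^sub>M K (\<lambda>_. lborel))"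
    by (rule measurable_compose) measurable
qed

lemma link_mass_measurable [measurable]:
  fixes T :: "nat set"
  assumes "finite T"
  shows "(\<lambda>x. link_mass \<tau> (image_mset x (mset_set T))) \<in> borel_measurable (Pi\<^sub>M T (\<lambda>_. lborel))"
  unfolding link_mass_def prod_mset_image_mset_set
proof (rule lborel.borel_measurable_nn_integral)
  show "(\<lambda>(x, y). ennreal (scaled_density \<tau> y) * indicator {1<..} y * (\<Prod>i\<in>T. ennreal (min 1 (x i * y))))
      \<in> borel_measurable (Pi\<^sub>M T (\<lambda>_. lborel) \<Otimes>\<^sub>M lborel)"
    by measurable
qed

lemma small_weight_measurable [measurable]:
  fixes T :: "nat set"
  assumes "finite T"
  shows "(\<lambda>x. small_weight \<tau> m r (image_mset x (mset_set T))) \<in> borel_measurable (Pi\<^sub>M T (\<lambda>_. lborel))"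
  unfolding small_weight_def prod_mset_image_mset_set using assms by measurable

definition clique_mass :: "real \<Rightarrow> nat set \<Rightarrow> ennreal" where
  "clique_mass \<tau> I = (\<integral>\<^sup>+x. (\<Prod>i\<in>I. ennreal (scaled_density \<tau> (x i))) * ennreal (pair_prod I x) \<partial>Pi\<^sub>M I (\<lambda>_. lborel))"

lemma clique_mass_split_term:
  assumes "finite T" "finite U" "T \<inter> U = {}" and \<tau>: "1 < \<tau>"
  shows "(\<integral>\<^sup>+z. (\<Prod>i\<in>T. ennreal (scaled_density \<tau> (z i)) * indicator {..1} (z i)) *
             (\<Prod>i\<in>U. ennreal (scaled_density \<tau> (z i)) * indicator {1<..} (z i)) *
             ennreal (pair_prod (T \<union> U) z) \<partial>Pi\<^sub>M (T \<union> U) (\<lambda>_. lborel)) =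
         (\<integral>\<^sup>+x. (\<Prod>i\<in>T. indicator {0<..1} (x i)) *
             small_weight \<tau> (card T) (card U) (image_mset x (mset_set T)) \<partial>Pi\<^sub>M T (\<lambda>_. lborel))"
proof -
  define w where "w y = ennreal (scaled_density \<tau> y)" for y
  have [measurable]: "w \<in> borel_measurable borel" unfolding w_def by measurable
  define F where "F z = (\<Prod>i\<in>T. w (z i) * indicator {..1} (z i)) *
             (\<Prod>i\<in>U. w (z i) * indicator {1<..} (z i)) * ennreal (pair_prod (T \<union> U) z)" for z
  have [measurable]: "F \<in> borel_measurable (Pi\<^sub>M (T \<union> U) (\<lambda>_. lborel))"
  proof -
    have [measurable]: "(\<lambda>z. \<Prod>i\<in>T. w (z i) * indicator {..1} (z i)) \<in> borel_measurable (Pi\<^sub>M (T \<union> U) (\<lambda>_. lborel))"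
      by (intro prod_components_measurable[of _ _ "\<lambda>y. w y * indicator {..1} y"]) auto
    have [measurable]: "(\<lambda>z. \<Prod>i\<in>U. w (z i) * indicator {1<..} (z i)) \<in> borel_measurable (Pi\<^sub>M (T \<union> U) (\<lambda>_. lborel))"
      by (intro prod_components_measurable[of _ _ "\<lambda>y. w y * indicator {1<..} y"]) auto
    have [measurable]: "pair_prod (T \<union> U) \<in> borel_measurable (Pi\<^sub>M (T \<union> U) (\<lambda>_. lborel))"
      using assms(1,2) by (intro pair_prod_measurable) auto
    show ?thesis unfolding F_def by measurable
  qed
  \<comment> \<open>\<open>card T - 1\<close> is truncated subtraction, so the exponents match only
    for nonempty \<open>T\<close>; inside a product over \<open>T\<close> this is automatic.\<close>
  have small: "(w y * indicator {..1} y) * ennreal (y ^ (card T - 1)) =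
      indicator {0<..1} y * ennreal ((\<tau> - 1) * y powr (real (card T) - 1 - \<tau>))" if "T \<noteq> {}" for y
  proof (cases "0 < y \<and> y \<le> 1")
    case True
    have "1 \<le> card T" using that assms(1) by (simp add: Suc_le_eq card_gt_0_iff)
    then have "y powr (- \<tau>) * y ^ (card T - 1) = y powr (real (card T) - 1 - \<tau>)"
      using True by (subst powr_realpow[symmetric]) (simp_all add: powr_add[symmetric] of_nat_diff)
    then have "(\<tau> - 1) * y powr (- \<tau>) * y ^ (card T - 1) = (\<tau> - 1) * y powr (real (card T) - 1 - \<tau>)"
      by (simp only: mult.assoc)
    then show ?thesis using True \<tau> by (simp add: w_def scaled_density_def ennreal_mult[symmetric])
  qed (auto simp: w_def scaled_density_def indicator_def)
  have pointwise: "F (merge T U (x, y)) =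
      ((\<Prod>i\<in>T. w (x i) * indicator {..1} (x i)) * (\<Prod>i\<in>T. ennreal (x i ^ (card T - 1)))) *
      (\<Prod>u\<in>U. (w (y u) * indicator {1<..} (y u)) * (\<Prod>i\<in>T. ennreal (min 1 (x i * y u))))"
    (is "_ = ?R") for x y
  proof -
    define z where "z = merge T U (x, y)"
    have zT: "z i = x i" if "i \<in> T" for i using that by (simp add: z_def merge_def)
    have zU: "z i = y i" if "i \<in> U" for i using that assms(3) by (auto simp: z_def merge_def)
    have F: "F z = (\<Prod>i\<in>T. w (x i) * indicator {..1} (x i)) *
             (\<Prod>i\<in>U. w (y i) * indicator {1<..} (y i)) * ennreal (pair_prod (T \<union> U) z)"
      unfolding F_def using zT zU by simp
    show "F z = ?R"
    proof (cases "(\<forall>i\<in>T. 0 < x i \<and> x i \<le> 1) \<and> (\<forall>u\<in>U. 1 < y u)")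
      case True
      have "pair_prod (T \<union> U) z = (\<Prod>i\<in>T. z i ^ (card T - 1)) * (\<Prod>u\<in>U. \<Prod>i\<in>T. min 1 (z i * z u))"
        using True by (intro pair_prod_Un assms) (auto simp: zT zU)
      also have "\<dots> = (\<Prod>i\<in>T. x i ^ (card T - 1)) * (\<Prod>u\<in>U. \<Prod>i\<in>T. min 1 (x i * y u))"
        by (simp add: zT zU)
      also have "ennreal \<dots> = (\<Prod>i\<in>T. ennreal (x i ^ (card T - 1))) * (\<Prod>u\<in>U. \<Prod>i\<in>T. ennreal (min 1 (x i * y u)))"
      proof -
        have nn: "0 \<le> min 1 (x i * y u)" if "i \<in> T" "u \<in> U" for i u
        proof -
          have "0 < x i" "1 < y u" using True that by auto
          then show ?thesis by simp
        qed
        have "ennreal (\<Prod>u\<in>U. \<Prod>i\<in>T. min 1 (x i * y u)) = (\<Prod>u\<in>U. ennreal (\<Prod>i\<in>T. min 1 (x i * y u)))"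
          using nn by (intro prod_ennreal[symmetric] prod_nonneg) auto
        also have "\<dots> = (\<Prod>u\<in>U. \<Prod>i\<in>T. ennreal (min 1 (x i * y u)))"
          using nn by (intro prod.cong refl prod_ennreal[symmetric]) auto
        finally have 1: "ennreal (\<Prod>u\<in>U. \<Prod>i\<in>T. min 1 (x i * y u)) = (\<Prod>u\<in>U. \<Prod>i\<in>T. ennreal (min 1 (x i * y u)))" .
        have "ennreal (\<Prod>i\<in>T. x i ^ (card T - 1)) = (\<Prod>i\<in>T. ennreal (x i ^ (card T - 1)))"
          using True by (intro prod_ennreal[symmetric]) auto
        moreover have "0 \<le> (\<Prod>i\<in>T. x i ^ (card T - 1))" "0 \<le> (\<Prod>u\<in>U. \<Prod>i\<in>T. min 1 (x i * y u))"
          using True nn by (auto intro!: prod_nonneg)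
        ultimately show ?thesis using 1 by (simp add: ennreal_mult)
      qed
      finally show ?thesis unfolding F by (simp add: prod.distrib mult_ac)
    next
      case False
      \<comment> \<open>Outside the region a density or an indicator vanishes on both sides. The
        evaluation of \<open>pair_prod\<close> and the passage of \<open>ennreal\<close> through
        products rely on the ranges that hold inside it.\<close>
      then consider i where "i \<in> T" "\<not> (0 < x i \<and> x i \<le> 1)" | u where "u \<in> U" "\<not> 1 < y u" by blast
      then show ?thesis
      proof cases
        case 1
        then have "(\<Prod>i\<in>T. w (x i) * indicator {..1} (x i)) = 0"
          using assms(1) by (intro prod_zero bexI[of _ i]) (auto simp: w_def scaled_density_def)
        then show ?thesis unfolding F by (simp only: mult_zero_left)
      next
        case 2
        then have "(\<Prod>i\<in>U. w (y i) * indicator {1<..} (y i)) = 0"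
          using assms(2) by (intro prod_zero bexI[of _ u]) auto
        moreover from 2 have "(\<Prod>u\<in>U. (w (y u) * indicator {1<..} (y u)) * (\<Prod>i\<in>T. ennreal (min 1 (x i * y u)))) = 0"
          using assms(2) by (intro prod_zero bexI[of _ u]) auto
        ultimately show ?thesis unfolding F by (simp only: mult_zero_left mult_zero_right)
      qed
    qed
  qed
  have "(\<integral>\<^sup>+z. F z \<partial>Pi\<^sub>M (T \<union> U) (\<lambda>_. lborel)) =
        (\<integral>\<^sup>+x. \<integral>\<^sup>+y. F (merge T U (x, y)) \<partial>Pi\<^sub>M U (\<lambda>_. lborel) \<partial>Pi\<^sub>M T (\<lambda>_. lborel))"
    using assms by (intro lborel_product.product_nn_integral_fold) auto
  also have "\<dots> = (\<integral>\<^sup>+x. (\<Prod>i\<in>T. indicator {0<..1} (x i)) *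
             small_weight \<tau> (card T) (card U) (image_mset x (mset_set T)) \<partial>Pi\<^sub>M T (\<lambda>_. lborel))"
  proof (intro nn_integral_cong)
    fix x :: "nat \<Rightarrow> real"
    have "(\<integral>\<^sup>+y. F (merge T U (x, y)) \<partial>Pi\<^sub>M U (\<lambda>_. lborel)) =
      ((\<Prod>i\<in>T. w (x i) * indicator {..1} (x i)) * (\<Prod>i\<in>T. ennreal (x i ^ (card T - 1)))) *
      (\<integral>\<^sup>+y. (\<Prod>u\<in>U. (w (y u) * indicator {1<..} (y u)) * (\<Prod>i\<in>T. ennreal (min 1 (x i * y u)))) \<partial>Pi\<^sub>M U (\<lambda>_. lborel))"
      unfolding pointwise using assms(2) by (intro nn_integral_cmult) measurable
    also have "(\<integral>\<^sup>+y. (\<Prod>u\<in>U. (w (y u) * indicator {1<..} (y u)) * (\<Prod>i\<in>T. ennreal (min 1 (x i * y u)))) \<partial>Pi\<^sub>M U (\<lambda>_. lborel)) =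
        (\<Prod>u\<in>U. link_mass \<tau> (image_mset x (mset_set T)))"
      unfolding link_mass_def prod_mset_image_mset_set w_def
      by (intro lborel_product.product_nn_integral_prod assms(2)) measurable
    also have "(\<Prod>i\<in>T. w (x i) * indicator {..1} (x i)) * (\<Prod>i\<in>T. ennreal (x i ^ (card T - 1))) =
        (\<Prod>i\<in>T. indicator {0<..1} (x i) * ennreal ((\<tau> - 1) * x i powr (real (card T) - 1 - \<tau>)))"
      unfolding prod.distrib[symmetric] using small by (intro prod.cong refl) auto
    finally show "(\<integral>\<^sup>+y. F (merge T U (x, y)) \<partial>Pi\<^sub>M U (\<lambda>_. lborel)) =
        (\<Prod>i\<in>T. indicator {0<..1} (x i)) * small_weight \<tau> (card T) (card U) (image_mset x (mset_set T))"
      unfolding small_weight_def prod_mset_image_mset_set by (simp add: prod.distrib mult_ac)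
  qed
  finally show ?thesis unfolding F_def w_def .
qed

lemma clique_mass_eq_sum:
  assumes "finite K" and \<tau>: "1 < \<tau>"
  shows "clique_mass \<tau> K = (\<Sum>T\<in>Pow K. \<integral>\<^sup>+x. (\<Prod>i\<in>T. indicator {0<..1} (x i)) *
             small_weight \<tau> (card T) (card K - card T) (image_mset x (mset_set T)) \<partial>Pi\<^sub>M T (\<lambda>_. lborel))"
proof -
  define w where "w y = ennreal (scaled_density \<tau> y)" for y
  have [measurable]: "w \<in> borel_measurable borel" unfolding w_def by measurable
  have w: "w y = w y * indicator {..1} y + w y * indicator {1<..} y" for y
    by (auto simp: indicator_def)
  have "clique_mass \<tau> K = (\<integral>\<^sup>+x. (\<Sum>T\<in>Pow K. (\<Prod>i\<in>T. w (x i) * indicator {..1} (x i)) *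
      (\<Prod>i\<in>K - T. w (x i) * indicator {1<..} (x i)) * ennreal (pair_prod K x)) \<partial>Pi\<^sub>M K (\<lambda>_. lborel))"
  proof -
    have "(\<Prod>i\<in>K. w (x i)) = (\<Sum>T\<in>Pow K. (\<Prod>i\<in>T. w (x i) * indicator {..1} (x i)) *
        (\<Prod>i\<in>K - T. w (x i) * indicator {1<..} (x i)))" for x
      using prod_add[OF assms(1), of "\<lambda>i. w (x i) * indicator {..1} (x i)" "\<lambda>i. w (x i) * indicator {1<..} (x i)"]
      by (simp only: w[symmetric])
    then show ?thesis
      unfolding clique_mass_def w_def[symmetric] by (simp only: sum_distrib_right)
  qed
  also have "\<dots> = (\<Sum>T\<in>Pow K. \<integral>\<^sup>+x. (\<Prod>i\<in>T. w (x i) * indicator {..1} (x i)) *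
      (\<Prod>i\<in>K - T. w (x i) * indicator {1<..} (x i)) * ennreal (pair_prod K x) \<partial>Pi\<^sub>M K (\<lambda>_. lborel))"
  proof (rule nn_integral_sum)
    fix T assume T: "T \<in> Pow K"
    have [measurable]: "(\<lambda>x. \<Prod>i\<in>T. w (x i) * indicator {..1} (x i)) \<in> borel_measurable (Pi\<^sub>M K (\<lambda>_. lborel))"
      using T by (intro prod_components_measurable[of _ _ "\<lambda>y. w y * indicator {..1} y"]) auto
    have [measurable]: "(\<lambda>x. \<Prod>i\<in>K - T. w (x i) * indicator {1<..} (x i)) \<in> borel_measurable (Pi\<^sub>M K (\<lambda>_. lborel))"
      by (intro prod_components_measurable[of _ _ "\<lambda>y. w y * indicator {1<..} y"]) auto
    have [measurable]: "pair_prod K \<in> borel_measurable (Pi\<^sub>M K (\<lambda>_. lborel))"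
      using assms(1) by (rule pair_prod_measurable)
    show "(\<lambda>x. (\<Prod>i\<in>T. w (x i) * indicator {..1} (x i)) *
      (\<Prod>i\<in>K - T. w (x i) * indicator {1<..} (x i)) * ennreal (pair_prod K x)) \<in> borel_measurable (Pi\<^sub>M K (\<lambda>_. lborel))"
      by measurable
  qed
  also have "\<dots> = (\<Sum>T\<in>Pow K. \<integral>\<^sup>+x. (\<Prod>i\<in>T. indicator {0<..1} (x i)) *
             small_weight \<tau> (card T) (card K - card T) (image_mset x (mset_set T)) \<partial>Pi\<^sub>M T (\<lambda>_. lborel))"
  proof (intro sum.cong refl)
    fix T assume "T \<in> Pow K"
    then have T: "T \<union> (K - T) = K" "finite T" "finite (K - T)" "card (K - T) = card K - card T"
      using assms(1) by (auto simp: card_Diff_subset finite_subset)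
    show "(\<integral>\<^sup>+x. (\<Prod>i\<in>T. w (x i) * indicator {..1} (x i)) *
      (\<Prod>i\<in>K - T. w (x i) * indicator {1<..} (x i)) * ennreal (pair_prod K x) \<partial>Pi\<^sub>M K (\<lambda>_. lborel)) =
      (\<integral>\<^sup>+x. (\<Prod>i\<in>T. indicator {0<..1} (x i)) *
             small_weight \<tau> (card T) (card K - card T) (image_mset x (mset_set T)) \<partial>Pi\<^sub>M T (\<lambda>_. lborel))"
      using clique_mass_split_term[OF T(2,3) _ \<tau>] unfolding T(1,4) w_def by blast
  qed
  finally show ?thesis .
qed

lemma nn_integral_powr_unit:
  fixes a :: real
  assumes "-1 < a"
  shows "(\<integral>\<^sup>+y. indicator {0<..1} y * ennreal (y powr a) \<partial>lborel) = ennreal (1 / (a + 1))"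
proof -
  have "((\<lambda>y. if y \<in> {0..1} then y powr a else 0) has_integral (1 / (a + 1))) UNIV"
    using has_integral_powr_from_0[OF assms, of 1] by (subst has_integral_restrict_UNIV) simp
  then have "(\<integral>\<^sup>+y. ennreal (if y \<in> {0..1} then y powr a else 0) \<partial>lborel) = ennreal (1 / (a + 1))"
    by (intro nn_integral_has_integral_lborel) auto
  \<comment> \<open>At y = 0 both sides are 0, because \<open>0 powr a\<close> is 0 even for
    negative \<open>a\<close>.\<close>
  moreover have "ennreal (if y \<in> {0..1} then y powr a else 0) = indicator {0<..1} y * ennreal (y powr a)" for y
    by (auto simp: indicator_def)
  ultimately show ?thesis by simp
qed

lemma link_mass_eq_Phi:
  assumes \<tau>: "2 < \<tau>" "\<tau> < 3" and t: "\<And>i. i \<in> {1..m} \<Longrightarrow> 0 < t i \<and> t i \<le> 1" and m: "1 \<le> m"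
  shows "link_mass \<tau> (image_mset (\<lambda>i. \<Prod>l=i..m. t l) (mset_set {1..m})) = ennreal (Phi \<tau> m t)"
proof -
  define x where "x i = (\<Prod>l=i..m. t l)" for i
  have x_pos: "0 < x i" if "i \<in> {1..m}" for i
    unfolding x_def using t that by (intro prod_pos) auto
  have "link_mass \<tau> (image_mset x (mset_set {1..m})) =
     (\<integral>\<^sup>+y. ennreal (\<tau> - 1) * (ennreal (y powr (- \<tau>) * (\<Prod>i=1..m. min 1 (x i * y))) * indicator {1..} y) \<partial>lborel)"
    unfolding link_mass_def prod_mset_image_mset_set
  proof (intro nn_integral_cong_AE eventually_mono[OF AE_lborel_singleton[of 1]])
    fix y :: real assume "y \<noteq> 1"
    show "ennreal (scaled_density \<tau> y) * indicator {1<..} y * (\<Prod>i=1..m. ennreal (min 1 (x i * y))) =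
          ennreal (\<tau> - 1) * (ennreal (y powr (- \<tau>) * (\<Prod>i=1..m. min 1 (x i * y))) * indicator {1..} y)"
    proof (cases "1 < y")
      case True
      have nn: "0 \<le> min 1 (x i * y)" if "i \<in> {1..m}" for i
        using x_pos[OF that] True by simp
      then have "(\<Prod>i=1..m. ennreal (min 1 (x i * y))) = ennreal (\<Prod>i=1..m. min 1 (x i * y))"
        by (intro prod_ennreal) auto
      moreover have "0 \<le> (\<Prod>i=1..m. min 1 (x i * y))" using nn by (intro prod_nonneg) auto
      ultimately show ?thesis
        using True \<tau> by (simp add: scaled_density_def ennreal_mult[symmetric] mult.assoc)
    qed (use \<open>y \<noteq> 1\<close> in simp)
  qed
  also have "\<dots> = ennreal (\<tau> - 1) * edge_tail \<tau> x m 1"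
    unfolding edge_tail_def by (intro nn_integral_cmult) measurable
  also have "\<dots> = ennreal (Phi \<tau> m t)"
    unfolding x_def using t by (intro edge_tail_Phi \<tau> m) auto
  finally show ?thesis unfolding x_def[abs_def] .
qed

text \<open>\<open>f l\<close> occurs once for each i from 1 to l.\<close>

lemma prod_triangle:
  fixes f :: "nat \<Rightarrow> real"
  shows "(\<Prod>i=1..m. \<Prod>l=i..m. f l) = (\<Prod>l=1..m. f l ^ l)"
proof (induction m)
  case (Suc m)
  have "(\<Prod>i=1..Suc m. \<Prod>l=i..Suc m. f l) = (\<Prod>i=1..m. (\<Prod>l=i..m. f l) * f (Suc m)) * f (Suc m)"
    by (auto intro!: prod.cong arg_cong2[of _ _ _ _ "(*)"])
  then show ?case using Suc by (simp add: prod.distrib mult_ac)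
qed simp

text \<open>This is the exponent count for \<open>J\<close>: t_i receives i - 1 from the Jacobian
  and m - 1 - \<tau> from each of the i points containing it, and (i - 1) + i (m - 1 - \<tau>) = i
  (m - \<tau>) - 1.\<close>

lemma prod_powr_triangle:
  fixes t :: "nat \<Rightarrow> real"
  assumes "\<And>i. i \<in> {1..m} \<Longrightarrow> 0 < t i"
  shows "(\<Prod>i=1..m. t i ^ (i - 1) * (c * (\<Prod>l=i..m. t l) powr (real m - 1 - \<tau>))) =
     c ^ m * (\<Prod>i=1..m. t i powr (real i * (real m - \<tau>) - 1))"
proof -
  define a where "a = real m - 1 - \<tau>"
  have "(\<Prod>i=1..m. (\<Prod>l=i..m. t l) powr a) = (\<Prod>i=1..m. \<Prod>l=i..m. t l powr a)"
    by (intro prod.cong refl prod_powr_distrib)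
  also have "\<dots> = (\<Prod>l=1..m. (t l powr a) ^ l)" by (rule prod_triangle)
  finally have 1: "(\<Prod>i=1..m. (\<Prod>l=i..m. t l) powr a) = (\<Prod>l=1..m. (t l powr a) ^ l)" .
  have 2: "t i ^ (i - 1) * (t i powr a) ^ i = t i powr (real i * (real m - \<tau>) - 1)" if "i \<in> {1..m}" for i
  proof -
    have "0 < t i" "1 \<le> i" using assms that by auto
    then show ?thesis
      by (simp add: powr_realpow[symmetric] powr_powr powr_add[symmetric] of_nat_diff a_def algebra_simps)
  qed
  have "(\<Prod>i=1..m. t i ^ (i - 1) * (c * (\<Prod>l=i..m. t l) powr a)) =
      c ^ m * ((\<Prod>i=1..m. t i ^ (i - 1)) * (\<Prod>i=1..m. (\<Prod>l=i..m. t l) powr a))"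
    by (simp add: prod.distrib mult_ac)
  also have "\<dots> = c ^ m * (\<Prod>i=1..m. t i ^ (i - 1) * (t i powr a) ^ i)"
    unfolding 1 by (simp only: prod.distrib)
  also have "\<dots> = c ^ m * (\<Prod>i=1..m. t i powr (real i * (real m - \<tau>) - 1))"
    using 2 by (intro arg_cong2[of _ _ _ _ "(*)"] refl prod.cong) auto
  finally show ?thesis by (simp add: a_def)
qed

section \<open>The integrand of \<open>J\<close> in the ratio variables, and its
  integrability\<close>

definition J_integrand :: "real \<Rightarrow> nat \<Rightarrow> nat \<Rightarrow> (nat \<Rightarrow> real) \<Rightarrow> real" where
  "J_integrand \<tau> m r t = (\<Prod>i=1..m. t i powr (real i * (real m - \<tau>) - 1)) * Phi \<tau> m t ^ r"

lemma Phi_measurable [measurable]: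
  assumes "1 \<le> m"
  shows "Phi \<tau> m \<in> borel_measurable (Pi\<^sub>M {1..m} (\<lambda>_. lborel))"
proof -
  have c: "(\<lambda>t. t i) \<in> borel_measurable (Pi\<^sub>M {1..m} (\<lambda>_. lborel :: real measure))" if "i \<in> {1..m}" for i
    using measurable_component_singleton[OF that, of "\<lambda>_. lborel :: real measure"] by simp
  have p: "(\<lambda>t. t i powr e) \<in> borel_measurable (Pi\<^sub>M {1..m} (\<lambda>_. lborel :: real measure))" if "i \<in> {1..m}" for i e
    using c[OF that] by measurable
  have pp: "(\<lambda>t. \<Prod>i=2..j. t i powr e i) \<in> borel_measurable (Pi\<^sub>M {1..m} (\<lambda>_. lborel :: real measure))"
    if "j \<le> m" for j and e :: "nat \<Rightarrow> real"
    using that by (intro borel_measurable_prod p) auto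
  have [measurable]: "(\<lambda>t. t 1) \<in> borel_measurable (Pi\<^sub>M {1..m} (\<lambda>_. lborel :: real measure))"
    using assms by (intro c) auto
  have [measurable]: "(\<lambda>t. \<Prod>i=2..m. t i powr e i) \<in> borel_measurable (Pi\<^sub>M {1..m} (\<lambda>_. lborel :: real measure))"
    for e :: "nat \<Rightarrow> real" by (intro pp) auto
  have [measurable]: "(\<lambda>t. \<Prod>i=2..j-1. t i powr e i) \<in> borel_measurable (Pi\<^sub>M {1..m} (\<lambda>_. lborel :: real measure))"
    if "j \<in> {3..m}" for e :: "nat \<Rightarrow> real" and j using that by (intro pp) auto
  show ?thesis
  proof (cases "m = 1")
    case True
    then have eq: "Phi \<tau> m = (\<lambda>t. t 1 * ((\<tau> - 1) / (\<tau> - 2) - t 1 powr (\<tau> - 2) / (\<tau> - 2)))"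
      by (simp add: Phi_def fun_eq_iff)
    show ?thesis unfolding eq by measurable
  next
    case False
    then have "2 \<le> m" using assms by simp
    then show ?thesis
      unfolding Phi_eq_prod[OF \<open>2 \<le> m\<close>, abs_def] by measurable
  qed
qed

lemma J_integrand_measurable [measurable]:
  assumes "1 \<le> m"
  shows "J_integrand \<tau> m r \<in> borel_measurable (Pi\<^sub>M {1..m} (\<lambda>_. lborel))"
proof -
  note [measurable] = Phi_measurable[OF assms]
  show ?thesis unfolding J_integrand_def by measurable
qed

lemma J_integrand_nonneg:
  assumes "2 < \<tau>" "\<tau> < 3" "\<And>i. i \<in> {1..m} \<Longrightarrow> 0 < t i \<and> t i \<le> 1" "1 \<le> m"
  shows "0 \<le> J_integrand \<tau> m r t"
  unfolding J_integrand_def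
  using edge_tail_Phi(2)[OF assms] by (intro mult_nonneg_nonneg prod_nonneg) auto

text \<open>Jacobian, small-point densities and link masses combine into the integrand of
  \<open>J\<close>. The factor (\<tau>-1)^m collects the density constants of the small points;
  those of the large points are inside \<Phi>_m.\<close>

lemma small_weight_ordered:
  assumes \<tau>: "2 < \<tau>" "\<tau> < 3" and m: "1 \<le> m"
  shows "(\<Prod>i=1..m. indicator {0<..1} (t i) * ennreal (t i) ^ (i - 1)) *
      small_weight \<tau> m r (image_mset (\<lambda>i. \<Prod>l=i..m. t l) (mset_set {1..m})) =
    ennreal ((\<tau> - 1) ^ m) * ((\<Prod>i=1..m. indicator {0<..1} (t i)) * ennreal (J_integrand \<tau> m r t))"
proof (cases "\<forall>i\<in>{1..m}. 0 < t i \<and> t i \<le> 1")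
  case True
  then have t: "0 < t i \<and> t i \<le> 1" if "i \<in> {1..m}" for i using that by auto
  have Phi_nn: "0 \<le> Phi \<tau> m t" using t by (intro edge_tail_Phi(2) \<tau> m) auto
  have "small_weight \<tau> m r (image_mset (\<lambda>i. \<Prod>l=i..m. t l) (mset_set {1..m})) =
     (\<Prod>i=1..m. ennreal ((\<tau> - 1) * (\<Prod>l=i..m. t l) powr (real m - 1 - \<tau>))) * ennreal (Phi \<tau> m t) ^ r"
    unfolding small_weight_def prod_mset_image_mset_set using t by (subst link_mass_eq_Phi[OF \<tau> _ m]) auto
  moreover have "(\<Prod>i=1..m. indicator {0<..1} (t i) * ennreal (t i) ^ (i - 1)) = (\<Prod>i=1..m. ennreal (t i ^ (i - 1)))"
    using t by (intro prod.cong refl) (auto simp: ennreal_power less_imp_le)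
  moreover have "(\<Prod>i=1..m. ennreal (t i ^ (i - 1) * ((\<tau> - 1) * (\<Prod>l=i..m. t l) powr (real m - 1 - \<tau>)))) =
      (\<Prod>i=1..m. ennreal (t i ^ (i - 1))) * (\<Prod>i=1..m. ennreal ((\<tau> - 1) * (\<Prod>l=i..m. t l) powr (real m - 1 - \<tau>)))"
    unfolding prod.distrib[symmetric] using t \<tau> by (intro prod.cong refl ennreal_mult) (auto simp: less_imp_le)
  ultimately have "(\<Prod>i=1..m. indicator {0<..1} (t i) * ennreal (t i) ^ (i - 1)) *
      small_weight \<tau> m r (image_mset (\<lambda>i. \<Prod>l=i..m. t l) (mset_set {1..m})) =
     (\<Prod>i=1..m. ennreal (t i ^ (i - 1) * ((\<tau> - 1) * (\<Prod>l=i..m. t l) powr (real m - 1 - \<tau>)))) * ennreal (Phi \<tau> m t) ^ r"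
    by (simp only: mult.assoc)
  also have "(\<Prod>i=1..m. ennreal (t i ^ (i - 1) * ((\<tau> - 1) * (\<Prod>l=i..m. t l) powr (real m - 1 - \<tau>)))) =
     ennreal (\<Prod>i=1..m. t i ^ (i - 1) * ((\<tau> - 1) * (\<Prod>l=i..m. t l) powr (real m - 1 - \<tau>)))"
    using t \<tau> by (intro prod_ennreal) (auto simp: less_imp_le)
  also have "(\<Prod>i=1..m. t i ^ (i - 1) * ((\<tau> - 1) * (\<Prod>l=i..m. t l) powr (real m - 1 - \<tau>))) =
     (\<tau> - 1) ^ m * (\<Prod>i=1..m. t i powr (real i * (real m - \<tau>) - 1))"
    using t by (intro prod_powr_triangle) auto
  also have "ennreal \<dots> * ennreal (Phi \<tau> m t) ^ r = ennreal ((\<tau> - 1) ^ m) * ennreal (J_integrand \<tau> m r t)"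
    using \<tau> Phi_nn by (simp add: J_integrand_def ennreal_power ennreal_mult prod_nonneg mult.assoc)
  also have "ennreal (J_integrand \<tau> m r t) = (\<Prod>i=1..m. indicator {0<..1} (t i)) * ennreal (J_integrand \<tau> m r t)"
    using t by simp
  finally show ?thesis .
next
  case False
  then obtain i where i: "i \<in> {1..m}" "\<not> (0 < t i \<and> t i \<le> 1)" by auto
  then have "(\<Prod>i=1..m. indicator {0<..1} (t i) * ennreal (t i) ^ (i - 1)) = 0"
    by (intro prod_zero bexI[of _ i]) auto
  moreover from i have "(\<Prod>i=1..m. indicator {0<..1} (t i) :: ennreal) = 0"
    by (intro prod_zero bexI[of _ i]) auto
  ultimately show ?thesis by (simp only: mult_zero_left mult_zero_right)
qed

text \<open>Bounding \<Phi>_m by a multiple of its prefactor dominates the integrand by a product of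
  powers t_i^(b_i), which is integrable on the unit cube once every b_i exceeds -1. For i = 1 this
  reads m + r > \<tau>, which follows from m + r \<ge> 3.\<close>

lemma nn_integral_J_integrand_finite:
  assumes \<tau>: "2 < \<tau>" "\<tau> < 3" and m: "1 \<le> m" and r: "1 \<le> r" and k: "3 \<le> m + r"
  shows "(\<integral>\<^sup>+t. (\<Prod>i=1..m. indicator {0<..1} (t i)) * ennreal (J_integrand \<tau> m r t) \<partial>Pi\<^sub>M {1..m} (\<lambda>_. lborel)) < \<infinity>"
proof -
  define C where "C = (\<tau> - 1) / ((3 - \<tau>) * (\<tau> - 2))"
  define b where "b i = real i * (real m - \<tau>) - 1 + (if i = 1 then 1 else \<tau> - 1) * real r" for i :: nat
  have C: "0 \<le> C" using \<tau> by (simp add: C_def)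
  have b: "-1 < b i" if "i \<in> {1..m}" for i
  proof (cases "i = 1")
    case True
    have "3 \<le> real m + real r" using k by linarith
    then show ?thesis using True \<tau> by (simp add: b_def)
  next
    case False
    then have i: "2 \<le> i" "2 \<le> m" using that by auto
    define q where "q = (\<tau> - 1) * real r"
    have r1: "\<tau> - 1 \<le> q" using \<tau> r by (simp add: q_def)
    \<comment> \<open>For m \<ge> 3 the term i (m - \<tau>) is already nonnegative. For m = i = 2 it
      is negative, and r \<ge> 1 rescues it: 2 (2 - \<tau>) + (\<tau> - 1) = 3 - \<tau> > 0.\<close>
    show ?thesis
    proof (cases "m = 2")
      case True
      then have "i = 2" using i that by auto
      then have "b i = 2 * (2 - \<tau>) - 1 + q" using True by (simp add: b_def q_def)
      then show ?thesis using \<tau> r1 by simp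
    next
      case False
      then have "3 \<le> real m" using i by linarith
      then have "0 \<le> real i * (real m - \<tau>)" using \<tau> by simp
      moreover have "b i = real i * (real m - \<tau>) - 1 + q"
        using \<open>i \<noteq> 1\<close> by (simp add: b_def q_def)
      ultimately show ?thesis using r1 \<tau> by linarith
    qed
  qed
  have bound: "(\<Prod>i=1..m. indicator {0<..1} (t i)) * ennreal (J_integrand \<tau> m r t) \<le>
      ennreal (C ^ r) * (\<Prod>i=1..m. indicator {0<..1} (t i) * ennreal (t i powr b i))" for t
  proof (cases "\<forall>i\<in>{1..m}. 0 < t i \<and> t i \<le> 1")
    case True
    then have t: "0 < t i \<and> t i \<le> 1" if "i \<in> {1..m}" for i using that by auto
    have Phi_nn: "0 \<le> Phi \<tau> m t" using t by (intro edge_tail_Phi(2) \<tau> m) auto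
    have P: "t 1 * (\<Prod>i=2..m. t i powr (\<tau> - 1)) = (\<Prod>i=1..m. t i powr (if i = 1 then 1 else \<tau> - 1))"
    proof -
      have "{1..m} = insert 1 {2..m}" using m by auto
      moreover have "t 1 powr 1 = t 1" using t[of 1] m by simp
      ultimately show ?thesis by (auto intro!: prod.cong)
    qed
    have "Phi \<tau> m t \<le> C * (\<Prod>i=1..m. t i powr (if i = 1 then 1 else \<tau> - 1))"
      unfolding P[symmetric] C_def using t by (intro Phi_upper_bound \<tau> m) auto
    then have "Phi \<tau> m t ^ r \<le> (C * (\<Prod>i=1..m. t i powr (if i = 1 then 1 else \<tau> - 1))) ^ r"
      using Phi_nn by (intro power_mono)
    also have "\<dots> = C ^ r * (\<Prod>i=1..m. t i powr ((if i = 1 then 1 else \<tau> - 1) * real r))"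
    proof -
      have "(t i powr e) ^ r = t i powr (e * real r)" if "i \<in> {1..m}" for i e
        using t[OF that] by (simp add: powr_power mult.commute)
      then show ?thesis by (simp add: power_mult_distrib prod_power_distrib)
    qed
    finally have "J_integrand \<tau> m r t \<le> (\<Prod>i=1..m. t i powr (real i * (real m - \<tau>) - 1)) *
        (C ^ r * (\<Prod>i=1..m. t i powr ((if i = 1 then 1 else \<tau> - 1) * real r)))"
      unfolding J_integrand_def by (intro mult_left_mono prod_nonneg) auto
    also have "\<dots> = C ^ r * (\<Prod>i=1..m. t i powr b i)"
      by (simp only: b_def powr_add prod.distrib mult_ac)
    finally have "ennreal (J_integrand \<tau> m r t) \<le> ennreal (C ^ r * (\<Prod>i=1..m. t i powr b i))"
      by (rule ennreal_leI)
    also have "\<dots> = ennreal (C ^ r) * (\<Prod>i=1..m. ennreal (t i powr b i))"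
      using C by (simp add: ennreal_mult prod_nonneg prod_ennreal)
    finally show ?thesis using t by (simp add: prod.distrib)
  next
    case False
    then obtain i where "i \<in> {1..m}" "\<not> (0 < t i \<and> t i \<le> 1)" by auto
    then have "(\<Prod>i=1..m. indicator {0<..1} (t i) :: ennreal) = 0"
      by (intro prod_zero bexI[of _ i]) auto
    then show ?thesis by (simp only: mult_zero_left zero_le)
  qed
  have "(\<integral>\<^sup>+t. (\<Prod>i=1..m. indicator {0<..1} (t i)) * ennreal (J_integrand \<tau> m r t) \<partial>Pi\<^sub>M {1..m} (\<lambda>_. lborel)) \<le>
      (\<integral>\<^sup>+t. ennreal (C ^ r) * (\<Prod>i=1..m. indicator {0<..1} (t i) * ennreal (t i powr b i)) \<partial>Pi\<^sub>M {1..m} (\<lambda>_. lborel))"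
    by (intro nn_integral_mono bound)
  also have "\<dots> = ennreal (C ^ r) * (\<integral>\<^sup>+t. (\<Prod>i=1..m. indicator {0<..1} (t i) * ennreal (t i powr b i)) \<partial>Pi\<^sub>M {1..m} (\<lambda>_. lborel))"
    by (intro nn_integral_cmult) measurable
  also have "(\<integral>\<^sup>+t. (\<Prod>i=1..m. indicator {0<..1} (t i) * ennreal (t i powr b i)) \<partial>Pi\<^sub>M {1..m} (\<lambda>_. lborel)) =
      (\<Prod>i=1..m. \<integral>\<^sup>+y. indicator {0<..1} y * ennreal (y powr b i) \<partial>lborel)"
    by (intro lborel_product.product_nn_integral_prod) measurable
  also have "\<dots> = (\<Prod>i=1..m. ennreal (1 / (b i + 1)))"
    using b by (intro prod.cong refl nn_integral_powr_unit) auto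
  also have "\<dots> = ennreal (\<Prod>i=1..m. 1 / (b i + 1))"
    using b by (intro prod_ennreal) (force simp: field_simps)
  also have "ennreal (C ^ r) * \<dots> < \<infinity>"
    by (simp add: ennreal_mult_less_top)
  finally show ?thesis .
qed

text \<open>Finiteness rules out the default value 0 of the Bochner integral, so \<open>J\<close> is
  the true integral. The closed cube in its definition may be replaced by the half-open one because
  the integrand vanishes wherever some t_i is 0.\<close>

lemma J_eq_nn_integral:
  assumes \<tau>: "2 < \<tau>" "\<tau> < 3" and m: "1 \<le> m" "m < k" and k: "3 \<le> k"
  shows "ennreal (J \<tau> k m) =
      (\<integral>\<^sup>+t. (\<Prod>i=1..m. indicator {0<..1} (t i)) * ennreal (J_integrand \<tau> m (k - m) t) \<partial>Pi\<^sub>M {1..m} (\<lambda>_. lborel))"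
    and "0 \<le> J \<tau> k m"
proof -
  define r where "r = k - m"
  define f where "f t = (\<Prod>i=1..m. indicator {0<..1} (t i)) * J_integrand \<tau> m r t" for t
  have f_nn: "0 \<le> f t" for t
  proof (cases "\<forall>i\<in>{1..m}. 0 < t i \<and> t i \<le> 1")
    case True
    then show ?thesis unfolding f_def using J_integrand_nonneg[OF \<tau> _ m(1), of t r]
      by (intro mult_nonneg_nonneg prod_nonneg) auto
  next
    case False
    then obtain i where "i \<in> {1..m}" "\<not> (0 < t i \<and> t i \<le> 1)" by auto
    then have "(\<Prod>i=1..m. indicator {0<..1} (t i) :: real) = 0"
      by (intro prod_zero bexI[of _ i]) auto
    then show ?thesis by (simp only: f_def mult_zero_left order_refl)
  qed
  have [measurable]: "f \<in> borel_measurable (Pi\<^sub>M {1..m} (\<lambda>_. lborel))"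
  proof -
    note [measurable] = J_integrand_measurable[OF m(1)]
    show ?thesis unfolding f_def by measurable
  qed
  have ind: "ennreal (f t) = (\<Prod>i=1..m. indicator {0<..1} (t i)) * ennreal (J_integrand \<tau> m r t)" for t
  proof -
    have "ennreal (f t) = ennreal (\<Prod>i=1..m. indicator {0<..1} (t i)) * ennreal (J_integrand \<tau> m r t)"
    proof (cases "\<forall>i\<in>{1..m}. 0 < t i \<and> t i \<le> 1")
      case True
      then show ?thesis unfolding f_def using J_integrand_nonneg[OF \<tau> _ m(1), of t r]
        by (intro ennreal_mult prod_nonneg) auto
    next
      case False
      then obtain i where "i \<in> {1..m}" "\<not> (0 < t i \<and> t i \<le> 1)" by auto
      then have "(\<Prod>i=1..m. indicator {0<..1} (t i) :: real) = 0"
        by (intro prod_zero bexI[of _ i]) auto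
      then show ?thesis by (simp only: f_def mult_zero_left ennreal_0)
    qed
    also have "ennreal (\<Prod>i=1..m. indicator {0<..1} (t i)) = (\<Prod>i=1..m. indicator {0<..1} (t i))"
      by (subst prod_ennreal[symmetric]) (auto simp: ennreal_indicator)
    finally show ?thesis .
  qed
  have "J \<tau> k m = (\<integral>t. f t \<partial>Pi\<^sub>M {1..m} (\<lambda>_. lborel))"
    unfolding J_def set_lebesgue_integral_def
  proof (intro Bochner_Integration.integral_cong refl)
    fix t :: "nat \<Rightarrow> real" assume t: "t \<in> space (Pi\<^sub>M {1..m} (\<lambda>_. lborel))"
    show "indicator (\<Pi>\<^sub>E i\<in>{1..m}. {0..1}) t *\<^sub>R
       ((\<Prod>i=1..m. t i powr (real i * (real m - \<tau>) - 1)) * Phi \<tau> m t ^ (k - m)) = f t"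
    proof (cases "\<forall>i\<in>{1..m}. 0 < t i \<and> t i \<le> 1")
      case True
      then have "t \<in> (\<Pi>\<^sub>E i\<in>{1..m}. {0..1})"
        using t by (auto simp: space_PiM PiE_iff less_imp_le)
      then show ?thesis using True by (simp add: f_def J_integrand_def r_def)
    next
      case False
      then obtain i where i: "i \<in> {1..m}" "\<not> (0 < t i \<and> t i \<le> 1)" by auto
      then have "(\<Prod>i=1..m. indicator {0<..1} (t i) :: real) = 0"
        by (intro prod_zero bexI[of _ i]) auto
      then have "f t = 0" by (simp only: f_def mult_zero_left)
      \<comment> \<open>In the closed cube the only way to fail is t_i = 0, and
        \<open>0 powr e\<close> is 0 whatever the sign of the exponent.\<close>
      moreover have "(\<Prod>i=1..m. t i powr (real i * (real m - \<tau>) - 1)) = 0"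
        if "t \<in> (\<Pi>\<^sub>E i\<in>{1..m}. {0..1})"
      proof -
        have "0 \<le> t i" "t i \<le> 1" using that i(1) by (auto simp: PiE_iff)
        then have "t i = 0" using i(2) by auto
        then show ?thesis using i(1) by (intro prod_zero bexI[of _ i]) auto
      qed
      ultimately show ?thesis by (auto simp: indicator_def)
    qed
  qed
  moreover have "integrable (Pi\<^sub>M {1..m} (\<lambda>_. lborel)) f"
  proof (rule integrableI_nonneg)
    show "(\<integral>\<^sup>+t. ennreal (f t) \<partial>Pi\<^sub>M {1..m} (\<lambda>_. lborel)) < \<infinity>"
      unfolding ind using m k by (intro nn_integral_J_integrand_finite \<tau>) (auto simp: r_def)
  qed (simp_all only: f_nn always_eventually, measurable)
  ultimately have "ennreal (J \<tau> k m) = (\<integral>\<^sup>+t. ennreal (f t) \<partial>Pi\<^sub>M {1..m} (\<lambda>_. lborel))"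
    using f_nn by (simp add: nn_integral_eq_integral)
  then show "ennreal (J \<tau> k m) =
      (\<integral>\<^sup>+t. (\<Prod>i=1..m. indicator {0<..1} (t i)) * ennreal (J_integrand \<tau> m (k - m) t) \<partial>Pi\<^sub>M {1..m} (\<lambda>_. lborel))"
    unfolding ind r_def .
  show "0 \<le> J \<tau> k m"
    using f_nn \<open>J \<tau> k m = _\<close> by simp
qed

subsection \<open>The expected number of cliques\<close>

lemma clique_iff_nsets: "clique S E \<longleftrightarrow> [S]\<^bsup>2\<^esup> \<subseteq> E"
  unfolding clique_def by (auto simp: nsets_2_eq)

lemma prob_clique_conditional_graph:
  assumes "S \<subseteq> {1..n}"
  shows "measure_pmf.prob (conditional_graph n p h) {E. clique S E} =
         (\<Prod>e\<in>[S]\<^bsup>2\<^esup>. clip (p (h (Min e)) (h (Max e))))"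
proof -
  let ?A = "[{1..n}]\<^bsup>2\<^esup>" and ?p = "\<lambda>e. bernoulli_pmf (p (h (Min e)) (h (Max e)))"
  \<comment> \<open>Being a clique on \<open>S\<close> is a box event: the pairs inside
    \<open>S\<close> are forced to be edges and all others are free, so independence yields the
    product.\<close>
  define B where "B e = (if e \<in> [S]\<^bsup>2\<^esup> then {True} else UNIV)" for e
  have fin: "finite ?A" by (simp add: finite_imp_finite_nsets)
  have sub: "[S]\<^bsup>2\<^esup> \<subseteq> ?A" using assms by (rule nsets_mono)
  have "measure_pmf.prob (conditional_graph n p h) {E. clique S E} =
        measure_pmf.prob (Pi_pmf ?A False ?p) ((\<lambda>X. {e. X e}) -` {E. clique S E})"
    unfolding conditional_graph_def by (rule measure_map_pmf)
  also have "(\<lambda>X. {e. X e}) -` {E. clique S E} = Pi ?A B"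
    using sub by (auto simp: clique_iff_nsets B_def Pi_iff split: if_splits)
  also have "measure_pmf.prob (Pi_pmf ?A False ?p) (Pi ?A B) = (\<Prod>e\<in>?A. measure_pmf.prob (?p e) (B e))"
    using fin by (rule measure_Pi_pmf_Pi)
  also have "\<dots> = (\<Prod>e\<in>[S]\<^bsup>2\<^esup>. clip (p (h (Min e)) (h (Max e))))"
  proof (rule prod.mono_neutral_cong_right[OF fin sub])
    show "\<forall>e\<in>?A - [S]\<^bsup>2\<^esup>. measure_pmf.prob (?p e) (B e) = 1"
      by (auto simp: B_def)
    show "measure_pmf.prob (?p e) (B e) = clip (p (h (Min e)) (h (Max e)))" if "e \<in> [S]\<^bsup>2\<^esup>" for e
      using that by (auto simp: B_def measure_pmf_single bernoulli_pmf.rep_eq clip_def min_def max_def)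
  qed
  finally show ?thesis .
qed

text \<open>Since \<gamma>_n^2 is the mean weight times n, each endpoint of a pair takes one factor
  \<gamma>_n. The minimum with 1 is absorbed by \<open>clip\<close>, and the order of the endpoints
  by commutativity.\<close>

lemma clique_prob_connection_prob:
  assumes "0 < n" and \<tau>: "2 < \<tau>"
  shows "(\<Prod>e\<in>[S]\<^bsup>2\<^esup>. clip (connection_prob \<tau> n (h (Min e)) (h (Max e)))) = pair_prod S (\<lambda>i. h i / gamma_n \<tau> n)"
  unfolding pair_prod_def
proof (intro prod.cong refl)
  fix e assume "e \<in> [S]\<^bsup>2\<^esup>"
  then obtain a b where e: "e = {a, b}" "a \<noteq> b" by (auto elim: nsets2_E)
  have "0 < mean_weight \<tau> * real n" using assms by (simp add: mean_weight_def)
  then have g: "gamma_n \<tau> n * gamma_n \<tau> n = mean_weight \<tau> * real n"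
    by (simp add: gamma_n_def mult.commute)
  have "h (Min e) * h (Max e) = h a * h b"
    using e by (cases "a < b") (auto simp: min_def max_def)
  then have "clip (connection_prob \<tau> n (h (Min e)) (h (Max e))) = clip (min (h a * h b / (mean_weight \<tau> * real n)) 1)"
    by (simp add: connection_prob_def)
  also have "\<dots> = clip (h a * h b / (mean_weight \<tau> * real n))"
    by (auto simp: clip_def min_def max_def)
  also have "h a * h b / (mean_weight \<tau> * real n) = (\<Prod>i\<in>e. h i / gamma_n \<tau> n)"
    using e by (simp add: g[symmetric])
  finally show "clip (connection_prob \<tau> n (h (Min e)) (h (Max e))) = clip (\<Prod>i\<in>e. h i / gamma_n \<tau> n)" .
qed

lemma nn_integral_num_cliques:
  "(\<integral>\<^sup>+E. ennreal (real (num_cliques n k E)) \<partial>measure_pmf (conditional_graph n p h)) =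
     (\<Sum>S\<in>[{1..n}]\<^bsup>k\<^esup>. ennreal (\<Prod>e\<in>[S]\<^bsup>2\<^esup>. clip (p (h (Min e)) (h (Max e)))))"
proof -
  have fin: "finite ([{1..n}]\<^bsup>k\<^esup>)" by (simp add: finite_imp_finite_nsets)
  have "real (num_cliques n k E) = (\<Sum>S\<in>[{1..n}]\<^bsup>k\<^esup>. indicator {E. clique S E} E)" for E
    using fin by (simp add: num_cliques_def indicator_def sum.If_cases Int_def)
  then have "ennreal (real (num_cliques n k E)) = (\<Sum>S\<in>[{1..n}]\<^bsup>k\<^esup>. indicator {E. clique S E} E)" for E
    by (simp add: sum_ennreal[symmetric] ennreal_indicator del: sum_ennreal)
  then have "(\<integral>\<^sup>+E. ennreal (real (num_cliques n k E)) \<partial>measure_pmf (conditional_graph n p h)) =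
     (\<Sum>S\<in>[{1..n}]\<^bsup>k\<^esup>. emeasure (measure_pmf (conditional_graph n p h)) {E. clique S E})"
    by (simp add: nn_integral_sum)
  also have "\<dots> = (\<Sum>S\<in>[{1..n}]\<^bsup>k\<^esup>. ennreal (\<Prod>e\<in>[S]\<^bsup>2\<^esup>. clip (p (h (Min e)) (h (Max e)))))"
  proof (intro sum.cong refl)
    fix S assume "S \<in> [{1..n}]\<^bsup>k\<^esup>"
    then have "S \<subseteq> {1..n}" by (simp add: nsets_def)
    then show "emeasure (measure_pmf (conditional_graph n p h)) {E. clique S E} =
        ennreal (\<Prod>e\<in>[S]\<^bsup>2\<^esup>. clip (p (h (Min e)) (h (Max e))))"
      by (simp add: measure_pmf.emeasure_eq_measure prob_clique_conditional_graph)
  qed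
  finally show ?thesis .
qed

lemma pair_prod_scaled_measurable:
  fixes D :: "real measure"
  assumes "sets D = sets borel" "S \<subseteq> K"
  shows "(\<lambda>h. pair_prod S (\<lambda>i. h i / g)) \<in> borel_measurable (Pi\<^sub>M K (\<lambda>_. D))"
  unfolding pair_prod_def
proof (intro borel_measurable_prod measurable_compose[OF _ clip_measurable])
  fix e i assume "e \<in> [S]\<^bsup>2\<^esup>" "i \<in> e"
  then have "i \<in> K" using assms(2) by (auto simp: nsets_def)
  then have "(\<lambda>h. h i) \<in> Pi\<^sub>M K (\<lambda>_. D) \<rightarrow>\<^sub>M D" by (rule measurable_component_singleton)
  then have "(\<lambda>h. h i) \<in> borel_measurable (Pi\<^sub>M K (\<lambda>_. D))"
    by (simp add: measurable_cong_sets[OF refl assms(1)])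
  then show "(\<lambda>h. h i / g) \<in> borel_measurable (Pi\<^sub>M K (\<lambda>_. D))"
    by measurable
qed

text \<open>Exchangeability: pulling coordinates back along an injection from {1..k} into
  \<open>K\<close> both relabels \<open>S\<close> and integrates out the other coordinates, whose
  law has total mass 1.\<close>

lemma nn_integral_pair_prod_card:
  fixes D :: "real measure"
  assumes "prob_space D" and [measurable_cong]: "sets D = sets borel" and S: "finite K" "S \<subseteq> K" "card S = k"
  shows "(\<integral>\<^sup>+h. ennreal (pair_prod S (\<lambda>i. h i / g)) \<partial>Pi\<^sub>M K (\<lambda>_. D)) =
         (\<integral>\<^sup>+h. ennreal (pair_prod {1..k} (\<lambda>i. h i / g)) \<partial>Pi\<^sub>M {1..k} (\<lambda>_. D))"
proof -
  have "finite S" using S finite_subset by blast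
  then obtain f where f: "bij_betw f {1..k} S"
    using S(3) by (metis ex_bij_betw_nat_finite_1)
  then have inj: "inj_on f {1..k}" and img: "f ` {1..k} = S" by (auto simp: bij_betw_def)
  have meas: "(\<lambda>h. ennreal (pair_prod {1..k} (\<lambda>i. h i / g))) \<in> borel_measurable (Pi\<^sub>M {1..k} (\<lambda>_. D))"
    using pair_prod_scaled_measurable[OF assms(2) order_refl] by measurable
  have pp: "pair_prod S x = pair_prod {1..k} (\<lambda>i. x (f i))" for x
  proof -
    have "pair_prod S x = (\<Prod>e\<in>[{1..k}]\<^bsup>2\<^esup>. clip (\<Prod>i\<in>f ` e. x i))"
      unfolding pair_prod_def using bij_betw_nsets[OF f, of 2] by (rule prod.reindex_bij_betw[symmetric])
    also have "\<dots> = pair_prod {1..k} (\<lambda>i. x (f i))"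
      unfolding pair_prod_def
    proof (intro prod.cong refl)
      fix e assume "e \<in> [{1..k}]\<^bsup>2\<^esup>"
      then have "inj_on f e" using inj by (auto simp: nsets_def intro: inj_on_subset)
      then show "clip (\<Prod>i\<in>f ` e. x i) = clip (\<Prod>i\<in>e. x (f i))" by (simp add: prod.reindex)
    qed
    finally show ?thesis .
  qed
  have "Pi\<^sub>M {1..k} (\<lambda>_. D) = distr (Pi\<^sub>M K (\<lambda>_. D)) (Pi\<^sub>M {1..k} (\<lambda>_. D)) (\<lambda>h. \<lambda>i\<in>{1..k}. h (f i))"
  proof -
    have "f \<in> {1..k} \<rightarrow> K" using img S(2) by auto
    from distr_PiM_reindex[OF _ inj this, of "\<lambda>_. D"] assms(1) show ?thesis by simp
  qed
  then have "(\<integral>\<^sup>+h. ennreal (pair_prod {1..k} (\<lambda>i. h i / g)) \<partial>Pi\<^sub>M {1..k} (\<lambda>_. D)) =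
     (\<integral>\<^sup>+h. ennreal (pair_prod {1..k} (\<lambda>i. h i / g)) \<partial>distr (Pi\<^sub>M K (\<lambda>_. D)) (Pi\<^sub>M {1..k} (\<lambda>_. D)) (\<lambda>h. \<lambda>i\<in>{1..k}. h (f i)))"
    by simp
  also have "\<dots> = (\<integral>\<^sup>+h. ennreal (pair_prod {1..k} (\<lambda>i. (\<lambda>i\<in>{1..k}. h (f i)) i / g)) \<partial>Pi\<^sub>M K (\<lambda>_. D))"
  proof (rule nn_integral_distr)
    show "(\<lambda>h. ennreal (pair_prod {1..k} (\<lambda>i. h i / g))) \<in>
        borel_measurable (distr (Pi\<^sub>M K (\<lambda>_. D)) (Pi\<^sub>M {1..k} (\<lambda>_. D)) (\<lambda>h. \<lambda>i\<in>{1..k}. h (f i)))"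
      unfolding measurable_distr_eq1 by (rule meas)
    show "(\<lambda>h. \<lambda>i\<in>{1..k}. h (f i)) \<in> Pi\<^sub>M K (\<lambda>_. D) \<rightarrow>\<^sub>M Pi\<^sub>M {1..k} (\<lambda>_. D)"
      using img S(2) by (intro measurable_restrict measurable_component_singleton) auto
  qed
  also have "\<dots> = (\<integral>\<^sup>+h. ennreal (pair_prod S (\<lambda>i. h i / g)) \<partial>Pi\<^sub>M K (\<lambda>_. D))"
    unfolding pp by (intro nn_integral_cong arg_cong[of _ _ ennreal] pair_prod_cong) auto
  finally show ?thesis ..
qed

lemma avg_cliques_eq_nn_integral:
  assumes \<tau>: "2 < \<tau>" and n: "0 < n"
  shows "avg_cliques \<tau> k n = enn2real (of_nat (n choose k) *
     (\<integral>\<^sup>+h. ennreal (pair_prod {1..k} (\<lambda>i. h i / gamma_n \<tau> n))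
        \<partial>Pi\<^sub>M {1..k} (\<lambda>_. density lborel (\<lambda>x. ennreal (weight_density \<tau> x)))))"
proof -
  define D where "D = density lborel (\<lambda>x. ennreal (weight_density \<tau> x))"
  let ?p = "connection_prob \<tau> n"
  let ?C = "\<lambda>h. measure_pmf (conditional_graph n ?p h)"
  let ?P = "Pi\<^sub>M {1..n} (\<lambda>_. D)"
  have D: "prob_space D" unfolding D_def using \<tau> by (intro prob_space_weight) auto
  have sets_D: "sets D = sets borel" by (simp add: D_def)
  have "case_prod ?p \<in> borel_measurable (borel \<Otimes>\<^sub>M borel)"
    unfolding connection_prob_def by measurable
  then have "?C \<in> (\<Pi>\<^sub>M i\<in>{1..n}. borel) \<rightarrow>\<^sub>M prob_algebra (count_space UNIV)"
    by (rule conditional_graph_measurable)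
  then have "?C \<in> ?P \<rightarrow>\<^sub>M prob_algebra (count_space UNIV)"
    using sets_D by (subst measurable_cong_sets[OF sets_PiM_cong refl]) auto
  then have C: "?C \<in> ?P \<rightarrow>\<^sub>M subprob_algebra (count_space UNIV)"
    by (rule measurable_prob_algebraD)
  have "avg_cliques \<tau> k n = (\<integral>E. real (num_cliques n k E) \<partial>(?P \<bind> ?C))"
    by (simp add: avg_cliques_def inhomogeneous_random_graph_def D_def)
  \<comment> \<open>Both sides are 0 if the integral is infinite, so this identity precedes any
    finiteness statement.\<close>
  also have "\<dots> = enn2real (\<integral>\<^sup>+E. ennreal (real (num_cliques n k E)) \<partial>(?P \<bind> ?C))"
  proof (rule integral_eq_nn_integral)
    \<comment> \<open>The measurable sets of a bind are those of the kernel only over a nonempty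
      space; here they are all sets of graphs, so every function of the graph is measurable.\<close>
    have "space ?P \<noteq> {}"
      using D by (simp add: space_PiM PiE_eq_empty_iff prob_space.not_empty)
    then have "sets (?P \<bind> ?C) = sets (count_space UNIV)"
      by (intro sets_bind) (use C in \<open>auto dest: measurable_space simp: space_subprob_algebra\<close>)
    then have eq: "borel_measurable (?P \<bind> ?C) = borel_measurable (count_space UNIV)"
      by (rule measurable_cong_sets[OF _ refl])
    show "(\<lambda>E. real (num_cliques n k E)) \<in> borel_measurable (?P \<bind> ?C)" unfolding eq by simp
  qed auto
  also have "(\<integral>\<^sup>+E. ennreal (real (num_cliques n k E)) \<partial>(?P \<bind> ?C)) =
      (\<integral>\<^sup>+h. \<integral>\<^sup>+E. ennreal (real (num_cliques n k E)) \<partial>?C h \<partial>?P)"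
    by (intro nn_integral_bind[OF _ C]) auto
  also have "\<dots> = (\<integral>\<^sup>+h. (\<Sum>S\<in>[{1..n}]\<^bsup>k\<^esup>. ennreal (pair_prod S (\<lambda>i. h i / gamma_n \<tau> n))) \<partial>?P)"
    unfolding nn_integral_num_cliques clique_prob_connection_prob[OF n \<tau>] ..
  also have "\<dots> = (\<Sum>S\<in>[{1..n}]\<^bsup>k\<^esup>. \<integral>\<^sup>+h. ennreal (pair_prod S (\<lambda>i. h i / gamma_n \<tau> n)) \<partial>?P)"
  proof (rule nn_integral_sum)
    fix S assume "S \<in> [{1..n}]\<^bsup>k\<^esup>"
    then have "S \<subseteq> {1..n}" by (simp add: nsets_def)
    from pair_prod_scaled_measurable[OF sets_D this]
    show "(\<lambda>h. ennreal (pair_prod S (\<lambda>i. h i / gamma_n \<tau> n))) \<in> borel_measurable ?P"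
      by measurable
  qed
  also have "\<dots> = (\<Sum>S\<in>[{1..n}]\<^bsup>k\<^esup>. \<integral>\<^sup>+h. ennreal (pair_prod {1..k} (\<lambda>i. h i / gamma_n \<tau> n)) \<partial>Pi\<^sub>M {1..k} (\<lambda>_. D))"
    by (intro sum.cong refl nn_integral_pair_prod_card D sets_D) (auto simp: nsets_def)
  also have "\<dots> = of_nat (n choose k) * (\<integral>\<^sup>+h. ennreal (pair_prod {1..k} (\<lambda>i. h i / gamma_n \<tau> n)) \<partial>Pi\<^sub>M {1..k} (\<lambda>_. D))"
    by simp
  finally show ?thesis unfolding D_def .
qed

subsection \<open>The limit\<close>

definition clique_const :: "real \<Rightarrow> nat \<Rightarrow> real" where
  "clique_const \<tau> k = 1 + (\<Sum>m=1..k-1. real (k choose m) * (\<tau> - 1) ^ m * fact m * J \<tau> k m)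
             + ((\<tau> - 1) / (real k - \<tau>)) ^ k"

lemma sum_Pow_card:
  fixes g :: "nat \<Rightarrow> ennreal"
  assumes "finite K"
  shows "(\<Sum>T\<in>Pow K. g (card T)) = (\<Sum>m=0..card K. of_nat (card K choose m) * g m)"
proof -
  have "(\<Sum>T\<in>Pow K. g (card T)) = (\<Sum>m=0..card K. \<Sum>T\<in>{T \<in> Pow K. card T = m}. g (card T))"
    using assms by (intro sum.group[symmetric]) (auto intro: card_mono)
  also have "\<dots> = (\<Sum>m=0..card K. of_nat (card {T. T \<subseteq> K \<and> card T = m}) * g m)"
    by (intro sum.cong refl) simp
  finally show ?thesis using n_subsets[OF assms] by simp
qed

text \<open>The extreme subsets need no sorting. With no small point, every large point integrates
  to 1, as \<tau> - 1 normalises y^(-\<tau>) on (1, \<infinity>). With k small points the integral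
  splits into k copies of (\<tau>-1)/(k-\<tau>), convergent at 0 because k > \<tau>. The lower bound
  1 is recorded for the final division.\<close>

lemma clique_mass_eq:
  assumes \<tau>: "2 < \<tau>" "\<tau> < 3" and k: "3 \<le> k"
  shows "clique_mass \<tau> {1..k} = ennreal (clique_const \<tau> k)" and "1 \<le> clique_const \<tau> k"
proof -
  define v where "v m = (if m = 0 then 1 else if m < k then fact m * ((\<tau> - 1) ^ m * J \<tau> k m)
      else ((\<tau> - 1) / (real k - \<tau>)) ^ k)" for m :: nat
  have J_nn: "0 \<le> J \<tau> k m" if "1 \<le> m" "m < k" for m
    using that by (intro J_eq_nn_integral(2) \<tau> k)
  have v_nn: "0 \<le> v m" for m
    using J_nn[of m] \<tau> k by (auto simp: v_def)
  have v: "(\<integral>\<^sup>+x. (\<Prod>i\<in>T. indicator {0<..1} (x i)) *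
       small_weight \<tau> (card T) (card {1..k} - card T) (image_mset x (mset_set T)) \<partial>Pi\<^sub>M T (\<lambda>_. lborel)) = ennreal (v (card T))"
    if T: "T \<in> Pow {1..k}" for T
  proof -
    define m where "m = card T"
    have fin: "finite T" using T finite_subset by auto
    have le: "m \<le> k" using T card_mono[of "{1..k}" T] by (simp add: m_def)
    consider "m = 0" | "1 \<le> m" "m < k" | "m = k" using le by linarith
    then show ?thesis
    proof cases
      case 1
      then have "T = {}" using fin by (simp add: m_def)
      have "link_mass \<tau> {#} = (\<integral>\<^sup>+y. ennreal (\<tau> - 1) * (ennreal (1 * y powr (- \<tau>)) * indicator {1..} y) \<partial>lborel)"
        unfolding link_mass_def
        using \<tau> by (intro nn_integral_cong_AE eventually_mono[OF AE_lborel_singleton[of 1]])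
          (auto simp: scaled_density_def ennreal_mult indicator_def)
      also have "\<dots> = ennreal (\<tau> - 1) * ennreal (1 * (1 powr (- \<tau> + 1) / (- (- \<tau>) - 1)))"
        using \<tau> by (subst nn_integral_cmult, measurable) (subst nn_integral_powr_Ici, auto)
      also have "\<dots> = 1" using \<tau> by (simp add: ennreal_mult[symmetric])
      finally show ?thesis
        using \<open>T = {}\<close> by (simp add: small_weight_def v_def PiM_empty nn_integral_count_space_finite)
    next
      case 2
      have meas: "(\<lambda>t. (\<Prod>i=1..m. indicator {0<..1} (t i)) * ennreal (J_integrand \<tau> m (k - m) t))
          \<in> borel_measurable (Pi\<^sub>M {1..m} (\<lambda>_. lborel))"
      proof -
        note [measurable] = J_integrand_measurable[OF 2(1)]
        show ?thesis by measurable
      qed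
      have "(\<integral>\<^sup>+x. (\<Prod>i\<in>T. indicator {0<..1} (x i)) * small_weight \<tau> m (k - m) (image_mset x (mset_set T)) \<partial>Pi\<^sub>M T (\<lambda>_. lborel)) =
         fact m * (\<integral>\<^sup>+t. (\<Prod>i=1..m. indicator {0<..1} (t i) * ennreal (t i) ^ (i - 1)) *
            small_weight \<tau> m (k - m) (image_mset (\<lambda>i. \<Prod>l=i..m. t l) (mset_set {1..m})) \<partial>Pi\<^sub>M {1..m} (\<lambda>_. lborel))"
        using fin by (intro nn_integral_sort_unit_cube small_weight_measurable) (auto simp: m_def)
      also have "\<dots> = fact m * (\<integral>\<^sup>+t. ennreal ((\<tau> - 1) ^ m) *
          ((\<Prod>i=1..m. indicator {0<..1} (t i)) * ennreal (J_integrand \<tau> m (k - m) t)) \<partial>Pi\<^sub>M {1..m} (\<lambda>_. lborel))"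
        unfolding small_weight_ordered[OF \<tau> 2(1)] ..
      also have "\<dots> = fact m * (ennreal ((\<tau> - 1) ^ m) * ennreal (J \<tau> k m))"
        unfolding J_eq_nn_integral(1)[OF \<tau> 2 k] by (simp only: nn_integral_cmult[OF meas])
      also have "\<dots> = ennreal (fact m * ((\<tau> - 1) ^ m * J \<tau> k m))"
      proof -
        have "(fact m :: ennreal) = ennreal (fact m)"
          by (metis ennreal_of_nat_eq_real_of_nat of_nat_fact)
        then show ?thesis using \<tau> J_nn[OF 2] by (simp add: ennreal_mult)
      qed
      finally show ?thesis using 2 by (simp add: m_def v_def)
    next
      case 3
      have "(\<integral>\<^sup>+x. (\<Prod>i\<in>T. indicator {0<..1} (x i)) * small_weight \<tau> m (k - m) (image_mset x (mset_set T)) \<partial>Pi\<^sub>M T (\<lambda>_. lborel)) =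
        (\<integral>\<^sup>+x. (\<Prod>i\<in>T. indicator {0<..1} (x i) * ennreal ((\<tau> - 1) * x i powr (real k - 1 - \<tau>))) \<partial>Pi\<^sub>M T (\<lambda>_. lborel))"
        unfolding small_weight_def prod_mset_image_mset_set using 3 by (simp add: prod.distrib)
      also have "\<dots> = (\<Prod>i\<in>T. \<integral>\<^sup>+y. indicator {0<..1} y * ennreal ((\<tau> - 1) * y powr (real k - 1 - \<tau>)) \<partial>lborel)"
        by (intro lborel_product.product_nn_integral_prod fin) measurable
      also have "(\<integral>\<^sup>+y. indicator {0<..1} y * ennreal ((\<tau> - 1) * y powr (real k - 1 - \<tau>)) \<partial>lborel) =
          (\<integral>\<^sup>+y. ennreal (\<tau> - 1) * (indicator {0<..1} y * ennreal (y powr (real k - 1 - \<tau>))) \<partial>lborel)"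
        using \<tau> by (intro nn_integral_cong) (simp add: ennreal_mult mult.left_commute)
      also have "\<dots> = ennreal (\<tau> - 1) * ennreal (1 / (real k - 1 - \<tau> + 1))"
        using \<tau> k by (subst nn_integral_cmult, measurable) (subst nn_integral_powr_unit, auto)
      also have "\<dots> = ennreal ((\<tau> - 1) / (real k - \<tau>))"
        using \<tau> k by (simp add: ennreal_mult[symmetric])
      finally show ?thesis
        using 3 \<tau> k by (simp add: m_def v_def ennreal_power)
    qed
  qed
  have "clique_mass \<tau> {1..k} = (\<Sum>T\<in>Pow {1..k}. ennreal (v (card T)))"
  proof -
    have "1 < \<tau>" using \<tau> by simp
    show ?thesis
      unfolding clique_mass_eq_sum[OF finite_atLeastAtMost \<open>1 < \<tau>\<close>] by (intro sum.cong refl v)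
  qed
  also have "\<dots> = (\<Sum>m=0..k. of_nat (k choose m) * ennreal (v m))"
    using sum_Pow_card[of "{1..k}" "\<lambda>m. ennreal (v m)"] by simp
  also have "\<dots> = (\<Sum>m=0..k. ennreal (real (k choose m) * v m))"
    using v_nn by (simp add: ennreal_mult ennreal_of_nat_eq_real_of_nat)
  also have "\<dots> = ennreal (\<Sum>m=0..k. real (k choose m) * v m)"
    using v_nn by (intro sum_ennreal) auto
  also have "(\<Sum>m=0..k. real (k choose m) * v m) = clique_const \<tau> k"
  proof -
    have "{0..k} = insert 0 (insert k {1..k-1})" using k by auto
    moreover have "v k = ((\<tau> - 1) / (real k - \<tau>)) ^ k" "v 0 = 1" using k by (auto simp: v_def)
    moreover have "(\<Sum>m=1..k-1. real (k choose m) * v m) =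
        (\<Sum>m=1..k-1. real (k choose m) * (\<tau> - 1) ^ m * fact m * J \<tau> k m)"
      using k by (intro sum.cong refl) (auto simp: v_def)
    ultimately show ?thesis using k by (simp add: clique_const_def)
  qed
  finally show "clique_mass \<tau> {1..k} = ennreal (clique_const \<tau> k)" .
  have "0 \<le> (\<Sum>m=1..k-1. real (k choose m) * (\<tau> - 1) ^ m * fact m * J \<tau> k m)"
    using \<tau> k by (intro sum_nonneg mult_nonneg_nonneg J_nn) auto
  moreover have "0 \<le> ((\<tau> - 1) / (real k - \<tau>)) ^ k" using \<tau> k by simp
  ultimately show "1 \<le> clique_const \<tau> k" by (simp add: clique_const_def)
qed

section \<open>Rescaling the weights and removing the truncation\<close>

definition truncated_mass :: "real \<Rightarrow> nat set \<Rightarrow> real \<Rightarrow> ennreal" where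
  "truncated_mass \<tau> I g = (\<integral>\<^sup>+x. (\<Prod>i\<in>I. ennreal (scaled_density \<tau> (x i)) * indicator {1 / g..} (x i)) *
      ennreal (pair_prod I x) \<partial>Pi\<^sub>M I (\<lambda>_. lborel))"

text \<open>Each coordinate yields g from dh and g^(-\<tau>) from the density, hence g^(1-\<tau>).
  The weights start at 1, so the rescaled points start at 1/g, and this cut-off is all that still
  depends on g.\<close>

lemma nn_integral_weights_scaled:
  assumes \<tau>: "1 < \<tau>" and g: "0 < g" and I: "finite I"
  shows "(\<integral>\<^sup>+h. ennreal (pair_prod I (\<lambda>i. h i / g)) \<partial>Pi\<^sub>M I (\<lambda>_. density lborel (\<lambda>x. ennreal (weight_density \<tau> x)))) =
         ennreal (g powr (real (card I) * (1 - \<tau>))) * truncated_mass \<tau> I g"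
proof -
  define w where "w x = ennreal (weight_density \<tau> x)" for x
  have [measurable]: "w \<in> borel_measurable borel" unfolding w_def by measurable
  have w: "ennreal g * w (g * y) = ennreal (g powr (1 - \<tau>)) * (ennreal (scaled_density \<tau> y) * indicator {1 / g..} y)" for y
  proof (cases "1 / g \<le> y")
    case True
    then have y: "0 < y" "1 \<le> g * y" using g by (auto simp: field_simps less_le_trans[of 0 "1 / g"])
    have "g * ((\<tau> - 1) * (g * y) powr (- \<tau>)) = g powr (1 - \<tau>) * ((\<tau> - 1) * y powr (- \<tau>))"
    proof -
      have "g * (g * y) powr (- \<tau>) = (g * g powr (- \<tau>)) * y powr (- \<tau>)"
        using g y by (simp add: powr_mult)
      also have "g * g powr (- \<tau>) = g powr (1 - \<tau>)"
        using g by (simp add: powr_mult_base)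
      finally show ?thesis by (simp add: mult_ac)
    qed
    then show ?thesis
      using True y g \<tau> by (simp add: w_def weight_density_def scaled_density_def ennreal_mult[symmetric])
  next
    case False
    then have "\<not> 1 \<le> g * y" using g by (simp add: field_simps)
    then show ?thesis using False by (simp add: w_def weight_density_def)
  qed
  have "sigma_finite_measure (density lborel w)"
    using prob_space_weight[OF \<tau>] unfolding w_def
    by (intro finite_measure.axioms(1) prob_space.finite_measure)
  moreover have meas [measurable]: "(\<lambda>h. ennreal (pair_prod I (\<lambda>i. h i / g))) \<in> borel_measurable (Pi\<^sub>M I (\<lambda>_. lborel))"
    using pair_prod_scaled_measurable[of lborel I I g] by simp
  ultimately have "(\<integral>\<^sup>+h. ennreal (pair_prod I (\<lambda>i. h i / g)) \<partial>Pi\<^sub>M I (\<lambda>_. density lborel w)) =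
      (\<integral>\<^sup>+h. (\<Prod>i\<in>I. w (h i)) * ennreal (pair_prod I (\<lambda>i. h i / g)) \<partial>Pi\<^sub>M I (\<lambda>_. lborel))"
    using I by (intro nn_integral_PiM_density) auto
  also have "\<dots> = ennreal g ^ card I * (\<integral>\<^sup>+x. (\<Prod>i\<in>I. w ((\<lambda>i\<in>I. g * x i) i)) *
      ennreal (pair_prod I (\<lambda>i. (\<lambda>i\<in>I. g * x i) i / g)) \<partial>Pi\<^sub>M I (\<lambda>_. lborel))"
    using I g by (intro nn_integral_PiM_lborel_scale) measurable
  also have "\<dots> = ennreal g ^ card I * (\<integral>\<^sup>+x. (\<Prod>i\<in>I. w (g * x i)) * ennreal (pair_prod I x) \<partial>Pi\<^sub>M I (\<lambda>_. lborel))"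
    using g by (intro arg_cong2[of _ _ _ _ "(*)"] refl nn_integral_cong arg_cong[of _ _ ennreal] pair_prod_cong prod.cong) auto
  also have "\<dots> = (\<integral>\<^sup>+x. ennreal g ^ card I * ((\<Prod>i\<in>I. w (g * x i)) * ennreal (pair_prod I x)) \<partial>Pi\<^sub>M I (\<lambda>_. lborel))"
    using I by (intro nn_integral_cmult[symmetric]) measurable
  also have "\<dots> = (\<integral>\<^sup>+x. ennreal (g powr (1 - \<tau>)) ^ card I * ((\<Prod>i\<in>I. ennreal (scaled_density \<tau> (x i)) * indicator {1 / g..} (x i)) *
      ennreal (pair_prod I x)) \<partial>Pi\<^sub>M I (\<lambda>_. lborel))"
  proof -
    have "ennreal g ^ card I * (\<Prod>i\<in>I. w (g * x i)) =
        ennreal (g powr (1 - \<tau>)) ^ card I * (\<Prod>i\<in>I. ennreal (scaled_density \<tau> (x i)) * indicator {1 / g..} (x i))" for x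
      unfolding prod_constant[symmetric] prod.distrib[symmetric] w ..
    then show ?thesis by (simp only: mult.assoc[symmetric])
  qed
  also have "\<dots> = ennreal (g powr (1 - \<tau>)) ^ card I * truncated_mass \<tau> I g"
    unfolding truncated_mass_def using I by (intro nn_integral_cmult) measurable
  also have "ennreal (g powr (1 - \<tau>)) ^ card I = ennreal (g powr (real (card I) * (1 - \<tau>)))"
    using g by (simp add: ennreal_power powr_power)
  finally show ?thesis unfolding w_def .
qed

lemma gamma_n_at_top:
  assumes "2 < \<tau>"
  shows "filterlim (gamma_n \<tau>) at_top sequentially"
proof -
  have "0 < mean_weight \<tau>" using assms by (simp add: mean_weight_def)
  then have "filterlim (\<lambda>n. real n * mean_weight \<tau>) at_top sequentially"
    by (intro filterlim_at_top_mult_tendsto_pos[OF tendsto_const] filterlim_real_sequentially)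
  then show ?thesis unfolding gamma_n_def by (rule filterlim_compose[OF sqrt_at_top])
qed

text \<open>Monotone convergence: \<gamma>_n increases, so the regions of integration grow to the
  open positive orthant while the rest of the integrand stays fixed.\<close>

lemma truncated_mass_tendsto:
  assumes \<tau>: "2 < \<tau>" and I: "finite I"
  shows "(\<lambda>n. truncated_mass \<tau> I (gamma_n \<tau> n)) \<longlonglongrightarrow> clique_mass \<tau> I"
proof -
  have mean: "0 < mean_weight \<tau>" using \<tau> by (simp add: mean_weight_def)
  \<comment> \<open>The index is shifted because \<gamma>_0 = 0 and 1 / 0 = 0 in HOL: at n = 0 the
    cut-off would be 0 and monotonicity would fail.\<close>
  define f where "f n x = (\<Prod>i\<in>I. ennreal (scaled_density \<tau> (x i)) * indicator {1 / gamma_n \<tau> (Suc n)..} (x i)) *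
      ennreal (pair_prod I x)" for n x
  have mono: "1 / gamma_n \<tau> (Suc n) \<le> 1 / gamma_n \<tau> (Suc m)" if "m \<le> n" for m n
    using that mean by (intro divide_left_mono) (auto simp: gamma_n_def)
  have "(\<lambda>n. integral\<^sup>N (Pi\<^sub>M I (\<lambda>_. lborel)) (f n)) \<longlonglongrightarrow>
     (\<integral>\<^sup>+x. (\<Prod>i\<in>I. ennreal (scaled_density \<tau> (x i))) * ennreal (pair_prod I x) \<partial>Pi\<^sub>M I (\<lambda>_. lborel))"
  proof (rule nn_integral_LIMSEQ)
    show "incseq f"
      unfolding incseq_def le_fun_def f_def
    proof (intro allI impI)
      fix m n :: nat and x :: "nat \<Rightarrow> real"
      assume "m \<le> n"
      then have ind: "indicator {1 / gamma_n \<tau> (Suc m)..} (x i) \<le> (indicator {1 / gamma_n \<tau> (Suc n)..} (x i) :: ennreal)" for i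
        using mono[of m n] by (auto simp: indicator_def)
      have "(\<Prod>i\<in>I. ennreal (scaled_density \<tau> (x i)) * indicator {1 / gamma_n \<tau> (Suc m)..} (x i)) \<le>
            (\<Prod>i\<in>I. ennreal (scaled_density \<tau> (x i)) * indicator {1 / gamma_n \<tau> (Suc n)..} (x i))"
        by (intro prod_mono_ennreal mult_left_mono ind) simp
      then show "(\<Prod>i\<in>I. ennreal (scaled_density \<tau> (x i)) * indicator {1 / gamma_n \<tau> (Suc m)..} (x i)) * ennreal (pair_prod I x) \<le>
            (\<Prod>i\<in>I. ennreal (scaled_density \<tau> (x i)) * indicator {1 / gamma_n \<tau> (Suc n)..} (x i)) * ennreal (pair_prod I x)"
        by (rule mult_right_mono) simp
    qed
    show "f n \<in> borel_measurable (Pi\<^sub>M I (\<lambda>_. lborel))" for n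
    proof -
      show ?thesis unfolding f_def using I by measurable
    qed
    show "(\<lambda>n. f n x) \<longlonglongrightarrow> (\<Prod>i\<in>I. ennreal (scaled_density \<tau> (x i))) * ennreal (pair_prod I x)" for x
    \<comment> \<open>At a fixed point the sequence is eventually constant: positive coordinates end
      up beyond the cut-off, and at the others the density is 0.\<close>
    proof (rule tendsto_eventually)
      have "\<forall>\<^sub>F n in sequentially. \<forall>i\<in>I. 0 < x i \<longrightarrow> 1 / gamma_n \<tau> (Suc n) \<le> x i"
      proof (intro eventually_ball_finite I ballI)
        fix i
        have "filterlim (\<lambda>n. gamma_n \<tau> (Suc n)) at_top sequentially"
          using gamma_n_at_top[OF \<tau>] by (subst filterlim_sequentially_Suc)
        \<comment> \<open>The bound 1 keeps \<gamma>_n positive, so that the inequality can be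
          inverted.\<close>
        then have "\<forall>\<^sub>F n in sequentially. max 1 (1 / x i) \<le> gamma_n \<tau> (Suc n)"
          by (simp only: filterlim_at_top)
        then show "\<forall>\<^sub>F n in sequentially. 0 < x i \<longrightarrow> 1 / gamma_n \<tau> (Suc n) \<le> x i"
        proof eventually_elim
          case (elim n)
          then show ?case by (auto simp: field_simps)
        qed
      qed
      then show "\<forall>\<^sub>F n in sequentially. f n x = (\<Prod>i\<in>I. ennreal (scaled_density \<tau> (x i))) * ennreal (pair_prod I x)"
      proof eventually_elim
        case (elim n)
        have "(\<Prod>i\<in>I. ennreal (scaled_density \<tau> (x i)) * indicator {1 / gamma_n \<tau> (Suc n)..} (x i)) =
              (\<Prod>i\<in>I. ennreal (scaled_density \<tau> (x i)))"
          using elim by (intro prod.cong refl) (auto simp: scaled_density_def)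
        then show ?case by (simp only: f_def)
      qed
    qed
  qed
  then have "(\<lambda>n. truncated_mass \<tau> I (gamma_n \<tau> (Suc n))) \<longlonglongrightarrow> clique_mass \<tau> I"
    unfolding f_def truncated_mass_def clique_mass_def .
  then show ?thesis by (rule LIMSEQ_imp_Suc)
qed

theorem theorem3p2:
  fixes \<tau> :: real and k :: nat
  assumes "2 < \<tau>" and "\<tau> < 3" and "k \<ge> 3"
  shows "(\<lambda>n. avg_cliques \<tau> k n) \<sim>[sequentially]
    (\<lambda>n. real (n choose k) * gamma_n \<tau> n powr (real k * (1 - \<tau>)) *
          (1 + (\<Sum>m=1..k-1. real (k choose m) * (\<tau> - 1) ^ m * fact m * J \<tau> k m)
             + ((\<tau> - 1) / (real k - \<tau>)) ^ k))"
proof -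
  let ?L = "clique_const \<tau> k" and ?T = "\<lambda>n. truncated_mass \<tau> {1..k} (gamma_n \<tau> n)"
  have L: "1 \<le> ?L" by (rule clique_mass_eq(2)[OF assms])
  have avg: "avg_cliques \<tau> k n = real (n choose k) * gamma_n \<tau> n powr (real k * (1 - \<tau>)) * enn2real (?T n)"
    if "0 < n" for n
  proof -
    have "0 < gamma_n \<tau> n" using that assms(1) by (simp add: gamma_n_def mean_weight_def)
    then have "avg_cliques \<tau> k n =
        enn2real (of_nat (n choose k) * (ennreal (gamma_n \<tau> n powr (real k * (1 - \<tau>))) * ?T n))"
      using avg_cliques_eq_nn_integral[OF assms(1) that, of k] nn_integral_weights_scaled[of \<tau> "gamma_n \<tau> n" "{1..k}"] assms(1)
      by simp
    then show ?thesis
      by (simp add: enn2real_mult mult.assoc ennreal_of_nat_eq_real_of_nat)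
  qed
  \<comment> \<open>\<open>enn2real\<close> preserves this limit because the limit is a finite
    nonnegative real.\<close>
  have "(\<lambda>n. enn2real (?T n)) \<longlonglongrightarrow> ?L"
  proof (rule tendsto_enn2real)
    show "?T \<longlonglongrightarrow> ennreal ?L"
      using truncated_mass_tendsto[OF assms(1), of "{1..k}"] clique_mass_eq(1)[OF assms] by simp
  qed (use L in auto)
  then have "(\<lambda>n. enn2real (?T n) / ?L) \<longlonglongrightarrow> ?L / ?L"
    using L by (intro tendsto_divide tendsto_const) auto
  then have lim: "(\<lambda>n. enn2real (?T n) / ?L) \<longlonglongrightarrow> 1" using L by simp
  have "(\<lambda>n. avg_cliques \<tau> k n / (real (n choose k) * gamma_n \<tau> n powr (real k * (1 - \<tau>)) * ?L)) \<longlonglongrightarrow> 1"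
  proof (rule Lim_transform_eventually[OF lim])
    show "\<forall>\<^sub>F n in sequentially. enn2real (?T n) / ?L =
        avg_cliques \<tau> k n / (real (n choose k) * gamma_n \<tau> n powr (real k * (1 - \<tau>)) * ?L)"
      \<comment> \<open>For n \<ge> k the binomial coefficient is nonzero and cancels in the
        quotient, as does the power of \<gamma>_n.\<close>
      using eventually_ge_at_top[of k]
    proof eventually_elim
      case (elim n)
      then have n: "0 < n" using assms(3) by simp
      have "0 < gamma_n \<tau> n" using n assms(1) by (simp add: gamma_n_def mean_weight_def)
      then show ?case using elim L by (simp add: avg[OF n] zero_less_binomial_iff)
    qed
  qed
  then have "avg_cliques \<tau> k \<sim>[sequentially] (\<lambda>n. real (n choose k) * gamma_n \<tau> n powr (real k * (1 - \<tau>)) * ?L)"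
    by (rule asymp_equivI')
  then show ?thesis unfolding clique_const_def .
qed

end
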